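(* Let $(S_\xi)_{\xi\in\Xi}$ be a nondegenerate family of balls in $\mathbb{R}^N$. Then $$ \pi(\Xi)=\pi^{\uparrow}(\pi_{\downarrow}(\Xi)). $$ In this event $S\in\mathscr{V}_NS$ with $S\neq\{0\}$ belongs to $\pi(\Xi)$ if and only if $$ S=\bigwedge_{x\in\mathbb{R}^N,\ x\ne 0}S(x)\bigvee_{S_0\in\pi_{\downarrow}(\Xi),\ S_0\ne\{0\}}\frac{S_0}{S_0(x)}. $$
   Context: $\mathscr{V}_N$ is the set of all nonempty compact convex subsets (convex figures) of $\mathbb{R}^N$. A figure $S$ is identified with its support function $S(z)=\sup\{(x,z): x\in S\}$, $z\in\mathbb{R}^N$, where $(\cdot,\cdot)$ is the standard inner product; thus $\mathscr{V}_N$ is a cone (with Minkowski addition and multiplication by nonnegative scalars $tS=\{ts:s\in S\}$) in the space $C(S_{N-1})$ of continuous functions on the Euclidean unit sphere $S_{N-1}$. The join $\bigvee$ is the closed convex hull of the union (its support function is the pointwise supremum), and the meet $\bigwedge$ is intersection. Closedness refers to the Hausdorff metric, i.e. the Chebyshev norm of support functions on $S_{N-1}$. A ball is a symmetric ($S=-S$) absorbing member of $\mathscr{V}_N$. $\mathscr{V}_NS$ is the set of all balls in $\mathbb{R}^N$ together with $\{0\}$; its members are called gauges. For a ball $S$, $\|x\|_S=\inf\{\alpha>0: x/\alpha\in S\}$ for $x\in\mathbb{R}^N$, and $\|A\|_S=\sup\{\|Ax\|_S: x\in S\}$ for a linear endomorphism $A$ of $\mathbb{R}^N$. A family $(S_\xi)_{\xi\in\Xi}$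 of balls (nonzero members of $\mathscr{V}_NS$) is nondegenerate if $\sup_{\xi\in\Xi}\|A\|_{S_\xi}<+\infty$ for every linear endomorphism $A$ of $\mathbb{R}^N$. For a nondegenerate family, the upper hull $\pi^{\uparrow}(\Xi)$, lower hull $\pi_{\downarrow}(\Xi)$, and hull $\pi(\Xi)$ are the least closed cones that lie in $\mathscr{V}_NS$, contain $S_\xi$ for all $\xi\in\Xi$, and are closed, respectively, under the binary join, under the binary meet, and under both operations of $\mathscr{V}_N$. For a set $H\subset\mathscr{V}_NS$, $\pi^{\uparrow}(H)$ denotes in the same way the least closed cone that lies in $\mathscr{V}_NS$, contains $H$, and is closed under the binary join. *)

theory Defs
  imports "HOL-Analysis.Analysis"
begin

definition convex_figures :: "'a::euclidean_space set set" where
  "convex_figures = {S. S \<noteq> {} \<and> compact S \<and> convex S}"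

definition support_fun :: "'a::euclidean_space set \<Rightarrow> 'a \<Rightarrow> real" where
  "support_fun S z = (SUP x\<in>S. x \<bullet> z)"

definition absorbing :: "'a::real_vector set \<Rightarrow> bool" where
  "absorbing S \<longleftrightarrow> (\<forall>x. \<exists>r>0. \<forall>t. \<bar>t\<bar> \<le> r \<longrightarrow> t *\<^sub>R x \<in> S)"

definition balls :: "'a::euclidean_space set set" where
  "balls = {S \<in> convex_figures. uminus ` S = S \<and> absorbing S}"

definition gauges :: "'a::euclidean_space set set" where
  "gauges = insert {0} balls"

definition ball_norm :: "'a::euclidean_space set \<Rightarrow> 'a \<Rightarrow> real" where
  "ball_norm S x = Inf {\<alpha>. \<alpha> > 0 \<and> x /\<^sub>R \<alpha> \<in> S}"

text \<open>For a ball \<open>S\<close> and a linear map \<open>A\<close>, the set over which the supremum is taken is nonempty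
  and bounded, so the real-valued \<open>SUP\<close> is the actual operator norm.\<close>

definition ball_onorm :: "'a::euclidean_space set \<Rightarrow> ('a \<Rightarrow> 'a) \<Rightarrow> real" where
  "ball_onorm S A = (SUP x\<in>S. ball_norm S (A x))"

definition nondegenerate :: "'i set \<Rightarrow> ('i \<Rightarrow> 'a::euclidean_space set) \<Rightarrow> bool" where
  "nondegenerate \<Xi> S \<longleftrightarrow>
     (\<forall>\<xi>\<in>\<Xi>. S \<xi> \<in> balls) \<and>
     (\<forall>A. linear A \<longrightarrow> bdd_above ((\<lambda>\<xi>. ball_onorm (S \<xi>) A) ` \<Xi>))"

definition join :: "'a::euclidean_space set set \<Rightarrow> 'a set" where
  "join F = closure (convex hull (\<Union>F))"

text \<open>Figures are identified with the restrictions of their support functions to the unit sphere;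
  a set of figures is closed if it is closed in the space of continuous functions on the sphere
  with the Chebyshev metric.\<close>

definition figures_closed :: "'a::euclidean_space set set \<Rightarrow> bool" where
  "figures_closed K \<longleftrightarrow>
     closedin (mtopology_of (cfunspace (top_of_set (sphere (0::'a) 1)) (euclidean_metric :: real metric)))
       ((\<lambda>S. restrict (support_fun S) (sphere 0 1)) ` K)"

text \<open>In the cone axioms, \<open>S + T\<close> is the Minkowski sum.\<close>

definition closed_gauge_cone :: "'a::euclidean_space set set \<Rightarrow> bool" where
  "closed_gauge_cone K \<longleftrightarrow>
     K \<noteq> {} \<and> K \<subseteq> gauges \<and> figures_closed K \<and>
     (\<forall>S\<in>K. \<forall>T\<in>K. S + T \<in> K) \<and>
     (\<forall>S\<in>K. \<forall>t\<ge>0. (*\<^sub>R) t ` S \<in> K)"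

definition join_closed :: "'a::euclidean_space set set \<Rightarrow> bool" where
  "join_closed K \<longleftrightarrow> (\<forall>S\<in>K. \<forall>T\<in>K. join {S, T} \<in> K)"

definition meet_closed :: "'a set set \<Rightarrow> bool" where
  "meet_closed K \<longleftrightarrow> (\<forall>S\<in>K. \<forall>T\<in>K. S \<inter> T \<in> K)"

text \<open>The least cones of the required kind, as intersections of all such cones. The set \<open>gauges\<close>
  itself is not closed (balls can converge to a segment), so in general no such cone need exist
  and the intersection is then \<open>UNIV\<close>. For a set \<open>H\<close> of members of a nondegenerate family this
  does not occur: if \<open>C A\<close> bounds the operator norms of each linear map \<open>A\<close>, then the gauges \<open>S\<close>
  with \<open>A ` S \<subseteq> (*\<^sub>R) (C A) ` S\<close> for all \<open>A\<close> form a closed cone stable under joins and meets.\<close>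

definition upper_hull :: "'a::euclidean_space set set \<Rightarrow> 'a set set" where
  "upper_hull H = (\<lambda>K. closed_gauge_cone K \<and> join_closed K) hull H"

definition lower_hull :: "'a::euclidean_space set set \<Rightarrow> 'a set set" where
  "lower_hull H = (\<lambda>K. closed_gauge_cone K \<and> meet_closed K) hull H"

definition full_hull :: "'a::euclidean_space set set \<Rightarrow> 'a set set" where
  "full_hull H = (\<lambda>K. closed_gauge_cone K \<and> join_closed K \<and> meet_closed K) hull H"

end

theory Submission
  imports Defs
begin

text \<open>
  A closed gauge cone \<open>K\<close> preorders the points: \<open>z\<close> is below \<open>x\<close> if \<open>h(z) \<le> h(x)\<close> for the support
  functions of all \<open>h\<close> in \<open>K\<close>. For \<open>K = \<pi>\<^sub>\<down>(\<Xi>)\<close>, both hulls coincide with the set \<open>G\<close> of gauges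
  whose support functions are monotone for this preorder, and monotonicity of \<open>S\<close> is what the
  formula for \<open>S\<close> expresses.

  If \<open>K\<close> is closed under meets, the preorder has the Riesz decomposition property: from
  \<open>h(z) \<le> h(x) + h(y)\<close> on \<open>K\<close> one obtains \<open>w\<close> with \<open>h(w) \<le> h(x)\<close> and \<open>h(z - w) \<le> h(y)\<close> on \<open>K\<close>. Indeed
  the support function of \<open>S \<inter> T\<close> is the infimal convolution of those of \<open>S\<close> and \<open>T\<close>, which settles
  single pairs \<open>S, T\<close> of \<open>K\<close> up to an error, and a minimax argument makes \<open>w\<close> uniform. The same
  convolution formula then shows that \<open>G\<close> is closed under meets, so \<open>\<pi>(\<Xi>) \<subseteq> G\<close>.

  For \<open>G \<subseteq> \<pi>\<^sup>\<up>(K)\<close>, another minimax argument reduces the approximation of a member of \<open>G\<close> from \<open>K\<close>,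
  up to an error above everywhere and below at one given point, to inequalities
  \<open>h(x) \<le> \<Sum>\<^sub>i h(y\<^sub>i)\<close> on \<open>K\<close>, which members of \<open>G\<close> inherit by iterated Riesz decomposition. Finite joins
  and compactness of the sphere finish the proof.
\<close>

subsection \<open>Support functions of convex figures\<close>

lemma convex_figuresD:
  assumes "S \<in> convex_figures"
  shows "S \<noteq> {}" "compact S" "convex S" "closed S" "bounded S"
  using assms by (auto simp: convex_figures_def compact_imp_closed compact_imp_bounded)

lemma inner_le_support_fun:
  assumes "S \<in> convex_figures" "s \<in> S"
  shows "s \<bullet> z \<le> support_fun S z"
proof -
  have "bdd_above ((\<lambda>x. x \<bullet> z) ` S)"
    by (intro bounded_imp_bdd_above compact_imp_bounded compact_continuous_image
        continuous_intros convex_figuresD[OF assms(1)])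
  then show ?thesis
    unfolding support_fun_def using assms(2) by (rule cSUP_upper[rotated])
qed

lemma support_fun_le:
  assumes "S \<in> convex_figures" "\<And>s. s \<in> S \<Longrightarrow> s \<bullet> z \<le> b"
  shows "support_fun S z \<le> b"
  unfolding support_fun_def using assms(2) convex_figuresD(1)[OF assms(1)]
  by (rule cSUP_least[rotated])

lemma support_fun_attained:
  assumes "S \<in> convex_figures"
  obtains s where "s \<in> S" "support_fun S z = s \<bullet> z"
proof -
  have "continuous_on S (\<lambda>x. x \<bullet> z)" by (intro continuous_intros)
  then obtain s where "s \<in> S" "\<forall>t\<in>S. t \<bullet> z \<le> s \<bullet> z"
    using continuous_attains_sup[OF convex_figuresD(2,1)[OF assms]] by blast
  then show ?thesis
    by (intro that[of s] antisym support_fun_le inner_le_support_fun assms) auto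
qed

lemma closed_convex_separation:
  fixes T :: "'a::euclidean_space set"
  assumes "closed T" "convex T" "s \<notin> T"
  obtains z c where "s \<bullet> z > c" "\<And>t. t \<in> T \<Longrightarrow> t \<bullet> z < c"
proof -
  obtain a b where "a \<bullet> s < b" "\<forall>x\<in>T. a \<bullet> x > b"
    using separating_hyperplane_closed_point[OF assms(2,1,3)] by blast
  then show ?thesis
    by (intro that[of "-b" "-a"]) (auto simp: inner_commute)
qed

text \<open>A point outside a closed convex set is strictly separated from it, so it violates the
  bound in some direction.\<close>

lemma mem_figure_iff:
  assumes "T \<in> convex_figures"
  shows "s \<in> T \<longleftrightarrow> (\<forall>z. s \<bullet> z \<le> support_fun T z)"
proof
  assume *: "\<forall>z. s \<bullet> z \<le> support_fun T z"
  show "s \<in> T"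
  proof (rule ccontr)
    assume "s \<notin> T"
    then obtain z c where zc: "s \<bullet> z > c" "\<And>t. t \<in> T \<Longrightarrow> t \<bullet> z < c"
      using closed_convex_separation convex_figuresD[OF assms] by metis
    then have "support_fun T z \<le> c"
      by (intro support_fun_le[OF assms]) (auto intro: less_imp_le)
    with zc(1) * show False by (meson leD le_less_trans)
  qed
qed (use inner_le_support_fun assms in blast)

lemma figure_subset_iff:
  assumes "S \<in> convex_figures" "T \<in> convex_figures"
  shows "S \<subseteq> T \<longleftrightarrow> (\<forall>z. support_fun S z \<le> support_fun T z)"
proof
  assume "S \<subseteq> T"
  then show "\<forall>z. support_fun S z \<le> support_fun T z"
    using inner_le_support_fun[OF assms(2)] by (auto intro!: support_fun_le[OF assms(1)])
next
  assume "\<forall>z. support_fun S z \<le> support_fun T z"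
  then show "S \<subseteq> T"
    using mem_figure_iff assms by (meson order_trans subsetI)
qed

lemma figure_eqI:
  assumes "S \<in> convex_figures" "T \<in> convex_figures"
    and "\<And>z. support_fun S z = support_fun T z"
  shows "S = T"
  using assms figure_subset_iff[of S T] figure_subset_iff[of T S] by auto

lemma support_fun_scale_arg:
  assumes "S \<in> convex_figures" "t \<ge> 0"
  shows "support_fun S (t *\<^sub>R z) = t * support_fun S z"
proof (rule antisym)
  show "support_fun S (t *\<^sub>R z) \<le> t * support_fun S z"
    by (rule support_fun_le[OF assms(1)])
      (simp add: assms mult_left_mono inner_le_support_fun)
  obtain s where "s \<in> S" "support_fun S z = s \<bullet> z"
    using support_fun_attained[OF assms(1)] .
  then show "t * support_fun S z \<le> support_fun S (t *\<^sub>R z)"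
    using inner_le_support_fun[OF assms(1), of s "t *\<^sub>R z"] by simp
qed

lemma support_fun_zero_arg [simp]: "S \<in> convex_figures \<Longrightarrow> support_fun S 0 = 0"
  using support_fun_scale_arg[of S 0 0] by simp

lemma support_fun_add_arg:
  assumes "S \<in> convex_figures"
  shows "support_fun S (x + y) \<le> support_fun S x + support_fun S y"
  by (rule support_fun_le[OF assms])
    (simp add: inner_add_right add_mono inner_le_support_fun assms)

lemma support_fun_normalize:
  assumes "S \<in> convex_figures"
  shows "support_fun S z = norm z * support_fun S (z /\<^sub>R norm z)"
  using support_fun_scale_arg[OF assms, of "norm z" "z /\<^sub>R norm z"] assms
  by (cases "z = 0") auto

lemma continuous_on_support_fun:
  assumes "S \<in> convex_figures"
  shows "continuous_on A (support_fun S)"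
proof -
  have "convex_on UNIV (support_fun S)"
  proof (rule convex_onI)
    fix t x y assume t: "0 < t" "t < (1::real)"
    have "support_fun S ((1 - t) *\<^sub>R x + t *\<^sub>R y)
      \<le> support_fun S ((1 - t) *\<^sub>R x) + support_fun S (t *\<^sub>R y)"
      using assms by (rule support_fun_add_arg)
    also have "\<dots> = (1 - t) * support_fun S x + t * support_fun S y"
      using t assms by (simp add: support_fun_scale_arg)
    finally show "support_fun S ((1 - t) *\<^sub>R x + t *\<^sub>R y) \<le> \<dots>" .
  qed simp
  then have "continuous_on UNIV (support_fun S)"
    by (intro convex_on_continuous) auto
  then show ?thesis
    by (rule continuous_on_subset) simp
qed

text \<open>Subadditivity bounds the increment by the value at \<open>x - y\<close>, which
  homogeneity reduces to the sphere. The constant depends on the figure only through its bound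
  there, so it can serve a whole class of figures.\<close>

lemma support_fun_Lipschitz:
  assumes "S \<in> convex_figures" "\<And>u. u \<in> sphere 0 1 \<Longrightarrow> support_fun S u \<le> M"
  shows "support_fun S x \<le> support_fun S y + M * dist x y"
proof -
  have "support_fun S x \<le> support_fun S y + support_fun S (x - y)"
    using support_fun_add_arg[OF assms(1), of y "x - y"] by simp
  also have "support_fun S (x - y) \<le> M * dist x y"
  proof (cases "x = y")
    case False
    have "support_fun S (x - y) = norm (x - y) * support_fun S ((x - y) /\<^sub>R norm (x - y))"
      using assms(1) by (rule support_fun_normalize)
    also have "\<dots> \<le> norm (x - y) * M"
      using False by (intro mult_left_mono assms(2)) auto
    finally show ?thesis by (simp add: dist_norm mult.commute)
  qed (use assms in simp)
  finally show ?thesis by simp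
qed

text \<open>Hahn-Banach through the epigraph, a closed convex cone: the slope of a hyperplane that
  separates it from a point just below the graph is a vector of \<open>W\<close> nearly attaining
  \<open>f\<close> at that point.\<close>

lemma sublinear_support_fun:
  fixes f :: "'a::euclidean_space \<Rightarrow> real"
  assumes add: "\<And>x y. f (x + y) \<le> f x + f y"
    and scale: "\<And>t x. t \<ge> 0 \<Longrightarrow> f (t *\<^sub>R x) = t * f x"
  defines "W \<equiv> {s. \<forall>z. s \<bullet> z \<le> f z}"
  shows "W \<in> convex_figures" "support_fun W = f"
proof -
  have f0: "f 0 = 0" using scale[of 0 0] by simp
  have "convex_on UNIV f"
  proof (rule convex_onI)
    fix t x y assume t: "0 < t" "t < (1::real)"
    show "f ((1 - t) *\<^sub>R x + t *\<^sub>R y) \<le> (1 - t) * f x + t * f y"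
      using add[of "(1 - t) *\<^sub>R x" "t *\<^sub>R y"] t by (simp add: scale)
  qed simp
  moreover from this have "continuous_on UNIV f"
    by (intro convex_on_continuous) auto
  then have "continuous_on UNIV (\<lambda>p::'a \<times> real. f (fst p))"
    by (rule continuous_on_compose2) (auto intro: continuous_intros)
  then have "closed {p. f (fst p) \<le> snd p}"
    by (intro closed_Collect_le continuous_intros)
  moreover have "epigraph UNIV f = {p. f (fst p) \<le> snd p}"
    by (auto simp: epigraph_def)
  ultimately have epi: "convex (epigraph UNIV f)" "closed (epigraph UNIV f)"
    by (metis convex_epigraph, metis)
  have W: "\<exists>s\<in>W. f x - e < s \<bullet> x" if e: "e > 0" for x e
  proof -
    have "(x, f x - e) \<notin> epigraph UNIV f"
      using e by (simp add: epigraph_def)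
    then obtain p c where p: "p \<bullet> (x, f x - e) < c" "\<And>q. q \<in> epigraph UNIV f \<Longrightarrow> c < p \<bullet> q"
      using separating_hyperplane_closed_point[OF epi] by blast
    obtain a b where ab: "p = (a, b)" by (cases p)
    have sep: "c < a \<bullet> y + b * r" if "f y \<le> r" for y r
      using p(2)[of "(y, r)"] that by (simp add: ab epigraph_def)
    have c: "c < 0" using sep[of 0 0] f0 by simp
    \<comment> \<open>The epigraph is a cone, so a negative value could be rescaled to be exactly
      \<open>c\<close>, against \<open>sep\<close>.\<close>
    have nonneg: "0 \<le> a \<bullet> y + b * r" if "f y \<le> r" for y r
    proof (rule ccontr)
      assume neg: "\<not> ?thesis"
      define t where "t = c / (a \<bullet> y + b * r)"
      have t: "t > 0" "t * (a \<bullet> y + b * r) = c"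
        using neg c by (auto simp: t_def divide_neg_neg)
      have "f (t *\<^sub>R y) \<le> t * r" using t that by (simp add: scale)
      from sep[OF this] have "c < t * (a \<bullet> y + b * r)" by (simp add: algebra_simps)
      with t show False by simp
    qed
    have "a \<bullet> x + b * (f x - e) < 0" using p(1) c by (simp add: ab)
    \<comment> \<open>The hyperplane is not vertical: the functional is negative at
      \<open>(x, f x - e)\<close> and nonnegative at \<open>(x, f x)\<close>.\<close>
    with nonneg[of x "f x"] have b: "b > 0"
      using e by (simp add: algebra_simps) (smt (verit) zero_less_mult_iff)
    define s where "s = - (a /\<^sub>R b)"
    have s: "s \<bullet> y = - (a \<bullet> y) / b" for y
      by (simp add: s_def divide_inverse mult.commute)
    have "s \<bullet> y \<le> f y" for y
      using nonneg[of y "f y"] b by (simp add: s field_simps)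
    moreover have "f x - e < s \<bullet> x"
      using \<open>a \<bullet> x + b * (f x - e) < 0\<close> b by (simp add: s field_simps)
    ultimately show ?thesis by (auto simp: W_def)
  qed
  have "bounded W"
  proof -
    have "norm s \<le> (\<Sum>b\<in>Basis. \<bar>f b\<bar> + \<bar>f (- b)\<bar>)" if "s \<in> W" for s
    proof (rule order_trans[OF norm_le_l1 sum_mono])
      fix b :: 'a
      have "s \<bullet> b \<le> f b" "s \<bullet> (- b) \<le> f (- b)"
        using that unfolding W_def by blast+
      then show "\<bar>s \<bullet> b\<bar> \<le> \<bar>f b\<bar> + \<bar>f (- b)\<bar>" by simp
    qed
    then show ?thesis unfolding bounded_iff by blast
  qed
  moreover have "W = (\<Inter>z. {s. z \<bullet> s \<le> f z})" by (auto simp: W_def inner_commute)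
  then have "closed W" "convex W"
    by (auto intro!: closed_halfspace_le convex_INT convex_halfspace_le)
  ultimately show fig: "W \<in> convex_figures"
    using W[of 1 0] by (auto simp: convex_figures_def compact_eq_bounded_closed)
  show "support_fun W = f"
  proof
    fix x
    show "support_fun W x = f x"
    proof (rule antisym)
      show "support_fun W x \<le> f x"
        by (rule support_fun_le[OF fig]) (simp add: W_def)
      show "f x \<le> support_fun W x"
      proof (rule field_le_epsilon)
        fix e :: real assume "e > 0"
        then obtain s where "s \<in> W" "f x - e < s \<bullet> x" using W by blast
        then show "f x \<le> support_fun W x + e"
          using inner_le_support_fun[OF fig, of s x] by simp
      qed
    qed
  qed
qed

subsection \<open>Gauges\<close>

text \<open>The minimum over the compact sphere serves as \<open>r\<close>; geometrically,
  \<open>T\<close> contains the Euclidean ball of this radius.\<close>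

lemma support_fun_lower_bound:
  fixes T :: "'a::euclidean_space set"
  assumes fig: "T \<in> convex_figures" and pos: "\<And>z. z \<noteq> 0 \<Longrightarrow> support_fun T z > 0"
  obtains r where "r > 0" "\<And>z. r * norm z \<le> support_fun T z"
proof -
  have "sphere (0::'a) 1 \<noteq> {}" by simp
  then obtain u where u: "u \<in> sphere 0 1"
      "\<And>v. v \<in> sphere 0 1 \<Longrightarrow> support_fun T u \<le> support_fun T (v::'a)"
    using continuous_attains_inf[OF compact_sphere _ continuous_on_support_fun[OF fig]] by blast
  show ?thesis
  proof (rule that)
    show "support_fun T u > 0" using u(1) by (intro pos) auto
    fix z
    show "support_fun T u * norm z \<le> support_fun T z"
    proof (cases "z = 0")
      case False
      then have "norm z * support_fun T u \<le> norm z * support_fun T (z /\<^sub>R norm z)"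
        by (intro mult_left_mono u) auto
      then show ?thesis
        using support_fun_normalize[OF fig, of z] by (simp add: mult.commute)
    qed (use fig in simp)
  qed
qed

lemma absorbingE:
  assumes "absorbing S"
  obtains r where "r > 0" "r *\<^sub>R x \<in> S"
proof -
  obtain r where "r > 0" "\<And>t. \<bar>t\<bar> \<le> r \<Longrightarrow> t *\<^sub>R x \<in> S"
    using assms unfolding absorbing_def by blast
  then show ?thesis by (intro that[of r]) auto
qed

text \<open>Symmetry becomes evenness and absorption becomes positivity off the origin, conditions
  that are easy to check for sums, joins and limits. Conversely, positivity gives absorption because
  the figure then contains a Euclidean ball around 0.\<close>

lemma gauges_iff:
  fixes T :: "'a::euclidean_space set"
  shows "T \<in> gauges \<longleftrightarrow> T \<in> convex_figures \<and> (\<forall>z. support_fun T (- z) = support_fun T z) \<and>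
    ((\<forall>z. support_fun T z = 0) \<or> (\<forall>z. z \<noteq> 0 \<longrightarrow> support_fun T z > 0))"
    (is "_ \<longleftrightarrow> ?R")
proof
  assume T: "T \<in> gauges"
  show ?R
  proof (cases "T = {0}")
    case True
    have "{0::'a} \<in> convex_figures" by (simp add: convex_figures_def)
    with True show ?thesis by (simp add: support_fun_def)
  next
    case False
    with T have fig: "T \<in> convex_figures" and sym: "uminus ` T = T" and abs: "absorbing T"
      by (auto simp: gauges_def balls_def)
    have "support_fun T (- z) \<le> support_fun T z" for z
    proof (rule support_fun_le[OF fig])
      fix s assume "s \<in> T"
      with sym have "- s \<in> T" by blast
      then show "s \<bullet> - z \<le> support_fun T z"
        using inner_le_support_fun[OF fig, of "- s" z] by simp
    qed
    from this this[of "- z" for z] have "support_fun T (- z) = support_fun T z" for z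
      by (simp add: antisym)
    moreover have "support_fun T z > 0" if "z \<noteq> 0" for z
    proof -
      obtain r where "r > 0" "r *\<^sub>R z \<in> T"
        using abs by (rule absorbingE)
      then show ?thesis
        using inner_le_support_fun[OF fig, of "r *\<^sub>R z" z] that
        by (smt (verit) inner_gt_zero_iff inner_scaleR_left mult_pos_pos)
    qed
    ultimately show ?thesis using fig by blast
  qed
next
  assume R: ?R
  then have fig: "T \<in> convex_figures" and sym: "\<And>z. support_fun T (- z) = support_fun T z"
    by auto
  show "T \<in> gauges"
  proof (cases "\<forall>z. support_fun T z = 0")
    case True
    have "{0::'a} \<in> convex_figures" by (simp add: convex_figures_def)
    then have "T = {0}"
      by (rule figure_eqI[OF fig]) (simp add: True, simp add: support_fun_def)
    then show ?thesis by (simp add: gauges_def)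
  next
    case False
    with R have pos: "\<And>z. z \<noteq> 0 \<Longrightarrow> support_fun T z > 0" by blast
    have "uminus ` T \<subseteq> T"
    proof clarify
      fix s assume s: "s \<in> T"
      have "- s \<bullet> z \<le> support_fun T z" for z
        using inner_le_support_fun[OF fig s, of "- z"] sym[of z] by simp
      then show "- s \<in> T" using mem_figure_iff[OF fig] by blast
    qed
    moreover from image_mono[OF this, of uminus] have "T \<subseteq> uminus ` T"
      by (simp add: image_image)
    ultimately have "uminus ` T = T" by blast
    moreover have "absorbing T"
      unfolding absorbing_def
    proof
      fix x :: 'a
      obtain r where r: "r > 0" "\<And>z. r * norm z \<le> support_fun T z"
        using support_fun_lower_bound[OF fig pos] by blast
      \<comment> \<open>The summand 1 keeps the denominator positive at
        \<open>x = 0\<close>.\<close>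
      let ?r = "r / (norm x + 1)"
      have "t *\<^sub>R x \<in> T" if t: "\<bar>t\<bar> \<le> ?r" for t
        unfolding mem_figure_iff[OF fig]
      proof
        fix z
        have "\<bar>t\<bar> * norm x \<le> r"
        proof (rule order_trans)
          show "\<bar>t\<bar> * norm x \<le> \<bar>t\<bar> * (norm x + 1)" by (intro mult_left_mono) auto
          have "0 < norm x + 1" by (simp add: add_nonneg_pos)
          then show "\<bar>t\<bar> * (norm x + 1) \<le> r"
            using t by (simp only: pos_le_divide_eq)
        qed
        have "(t *\<^sub>R x) \<bullet> z \<le> \<bar>t\<bar> * norm x * norm z"
          using norm_cauchy_schwarz[of "t *\<^sub>R x" z] by simp
        also have "\<dots> \<le> r * norm z"
          using \<open>\<bar>t\<bar> * norm x \<le> r\<close> by (rule mult_right_mono) simp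
        also have "\<dots> \<le> support_fun T z" by (rule r)
        finally show "(t *\<^sub>R x) \<bullet> z \<le> support_fun T z" .
      qed
      moreover have "?r > 0" using r by (simp add: add_nonneg_pos)
      ultimately show "\<exists>r>0. \<forall>t. \<bar>t\<bar> \<le> r \<longrightarrow> t *\<^sub>R x \<in> T" by blast
    qed
    ultimately show ?thesis using fig by (simp add: gauges_def balls_def)
  qed
qed

lemma gauges_figure: "T \<in> gauges \<Longrightarrow> T \<in> convex_figures"
  by (simp add: gauges_iff)

lemma support_fun_gauge_nonneg: "T \<in> gauges \<Longrightarrow> support_fun T z \<ge> 0"
  by (cases "z = 0") (auto simp: gauges_iff intro: less_imp_le)

lemma zero_mem_gauge: "T \<in> gauges \<Longrightarrow> 0 \<in> T"
  by (simp add: mem_figure_iff gauges_figure support_fun_gauge_nonneg)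

lemma zero_gauge: "{0} \<in> gauges"
  by (simp add: gauges_def)

lemma support_fun_singleton_zero [simp]: "support_fun {0} z = 0"
  by (simp add: support_fun_def)

lemma support_fun_gauge_pos:
  assumes "T \<in> gauges" "T \<noteq> {0}" "z \<noteq> 0"
  shows "support_fun T z > 0"
  using assms figure_eqI[of T "{0}"] gauges_figure[OF zero_gauge] by (auto simp: gauges_iff)

lemma gauge_eq_zero_iff:
  assumes "T \<in> gauges"
  shows "T = {0} \<longleftrightarrow> (\<forall>z. support_fun T z = 0)"
  using assms figure_eqI[of T "{0}"] gauges_figure[OF zero_gauge] by (auto simp: gauges_iff)

lemma gauge_eqI:
  assumes "S \<in> gauges" "T \<in> gauges"
    and "\<And>u. u \<in> sphere 0 1 \<Longrightarrow> support_fun S u = support_fun T u"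
  shows "S = T"
proof (rule figure_eqI)
  fix z
  show "support_fun S z = support_fun T z"
    using support_fun_normalize[of S z] support_fun_normalize[of T z] assms
    by (cases "z = 0") (auto simp: gauges_figure)
qed (use assms gauges_figure in auto)

section \<open>Sums, multiples, joins and meets of figures\<close>

lemma figure_plus:
  assumes "S \<in> convex_figures" "T \<in> convex_figures"
  shows "S + T \<in> convex_figures"
    and "support_fun (S + T) z = support_fun S z + support_fun T z"
proof -
  have eq: "S + T = {x + y |x y. x \<in> S \<and> y \<in> T}" by (auto simp: set_plus_def)
  have "compact (S + T)"
    unfolding eq using assms by (intro compact_sums convex_figuresD)
  moreover have "convex (S + T)"
    using assms by (intro convex_set_plus convex_figuresD)
  ultimately show fig: "S + T \<in> convex_figures"
    using assms by (auto simp: convex_figures_def)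
  obtain s where s: "s \<in> S" "support_fun S z = s \<bullet> z" using support_fun_attained assms(1) .
  obtain t where t: "t \<in> T" "support_fun T z = t \<bullet> z" using support_fun_attained assms(2) .
  show "support_fun (S + T) z = support_fun S z + support_fun T z"
  proof (rule antisym)
    show "support_fun (S + T) z \<le> support_fun S z + support_fun T z"
      using assms
      by (intro support_fun_le[OF fig]) (auto elim!: set_plus_elim simp: inner_add_left inner_le_support_fun add_mono)
    have "s + t \<in> S + T" using s t by auto
    then show "support_fun S z + support_fun T z \<le> support_fun (S + T) z"
      using inner_le_support_fun[OF fig, of "s + t" z] s t by (simp add: inner_add_left)
  qed
qed

lemma figure_scale:
  assumes "S \<in> convex_figures" "t \<ge> 0"
  shows "(*\<^sub>R) t ` S \<in> convex_figures"
    and "support_fun ((*\<^sub>R) t ` S) z = t * support_fun S z"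
proof -
  show fig: "(*\<^sub>R) t ` S \<in> convex_figures"
    using assms by (auto simp: convex_figures_def compact_scaling convex_scaling)
  obtain s where s: "s \<in> S" "support_fun S z = s \<bullet> z" using support_fun_attained assms(1) .
  show "support_fun ((*\<^sub>R) t ` S) z = t * support_fun S z"
  proof (rule antisym)
    show "support_fun ((*\<^sub>R) t ` S) z \<le> t * support_fun S z"
      using assms
      by (intro support_fun_le[OF fig]) (auto simp: inner_le_support_fun mult_left_mono)
    show "t * support_fun S z \<le> support_fun ((*\<^sub>R) t ` S) z"
      using inner_le_support_fun[OF fig imageI[OF s(1)], of z] s(2) by simp
  qed
qed

lemma figure_join:
  fixes S T :: "'a::euclidean_space set"
  assumes "S \<in> convex_figures" "T \<in> convex_figures"
  shows "join {S, T} \<in> convex_figures"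
    and "support_fun (join {S, T}) z = max (support_fun S z) (support_fun T z)"
proof -
  have "compact (convex hull (S \<union> T))"
    using assms by (intro compact_convex_hull compact_Un convex_figuresD)
  then have eq: "join {S, T} = convex hull (S \<union> T)" and fig: "convex hull (S \<union> T) \<in> convex_figures"
    using convex_figuresD[OF assms(1)]
    by (auto simp: join_def compact_imp_closed convex_figures_def)
  then show "join {S, T} \<in> convex_figures" by simp
  have "convex hull (S \<union> T) \<subseteq> {s. z \<bullet> s \<le> max (support_fun S z) (support_fun T z)}"
    using inner_le_support_fun[OF assms(1)] inner_le_support_fun[OF assms(2)]
    by (intro hull_minimal convex_halfspace_le) (force simp: inner_commute le_max_iff_disj)
  then have "support_fun (convex hull (S \<union> T)) z \<le> max (support_fun S z) (support_fun T z)"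
    by (intro support_fun_le[OF fig]) (auto simp: inner_commute)
  moreover have "S \<subseteq> convex hull (S \<union> T)" "T \<subseteq> convex hull (S \<union> T)"
    using hull_subset[of "S \<union> T" convex] by auto
  then have "max (support_fun S z) (support_fun T z) \<le> support_fun (convex hull (S \<union> T)) z"
    using assms fig by (simp add: figure_subset_iff)
  ultimately show "support_fun (join {S, T}) z = max (support_fun S z) (support_fun T z)"
    unfolding eq by (rule antisym)
qed

lemma figure_Int:
  assumes "S \<in> gauges" "T \<in> gauges"
  shows "S \<inter> T \<in> convex_figures"
  using assms zero_mem_gauge[of S] zero_mem_gauge[of T] gauges_figure[of S] gauges_figure[of T]
  by (auto simp: convex_figures_def compact_Int convex_Int)

text \<open>The easy half of the infimal convolution formula: a point of the meet obeys the bounds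
  of both gauges.\<close>

lemma support_fun_Int_le:
  assumes "S \<in> gauges" "T \<in> gauges"
  shows "support_fun (S \<inter> T) (x + y) \<le> support_fun S x + support_fun T y"
  by (rule support_fun_le[OF figure_Int[OF assms]])
    (simp add: assms inner_add_right add_mono inner_le_support_fun gauges_figure)

text \<open>The infimal convolution of the two support functions is sublinear, hence the support
  function of a figure, and that figure is contained in both sets.\<close>

lemma support_fun_Int_approx:
  fixes S T :: "'a::euclidean_space set"
  assumes "S \<in> gauges" "T \<in> gauges" "e > 0"
  obtains z where "support_fun S z + support_fun T (x - z) < support_fun (S \<inter> T) x + e"
proof -
  note fig = gauges_figure[OF assms(1)] gauges_figure[OF assms(2)]
  define h where "h x z = support_fun S z + support_fun T (x - z)" for x z
  define g where "g x = (INF z. h x z)" for x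
  have nonneg: "0 \<le> h x z" for x z
    using assms by (simp add: h_def support_fun_gauge_nonneg)
  then have bdd: "bdd_below (range (h x))" for x
    by (intro bdd_belowI[of _ 0]) auto
  have g_le: "g x \<le> h x z" for x z
    unfolding g_def using bdd by (rule cINF_lower) simp
  have g_approx: "\<exists>z. h x z < g x + e" if "e > 0" for x e
    using cINF_less_iff[OF _ bdd, of x "g x + e"] that by (auto simp: g_def)
  have add: "g (x + y) \<le> g x + g y" for x y
  proof (rule field_le_epsilon)
    fix e :: real assume "e > 0"
    then obtain z w where zw: "h x z < g x + e / 2" "h y w < g y + e / 2"
      using g_approx[of "e / 2"] by (meson half_gt_zero)
    have "h (x + y) (z + w) \<le> h x z + h y w"
      using support_fun_add_arg[OF fig(1), of z w] support_fun_add_arg[OF fig(2), of "x - z" "y - w"]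
      by (simp add: h_def algebra_simps)
    with zw g_le[of "x + y" "z + w"] show "g (x + y) \<le> g x + g y + e" by linarith
  qed
  have scale_le: "g (t *\<^sub>R x) \<le> t * g x" if t: "t > 0" for t x
  proof (rule field_le_epsilon)
    fix e :: real assume "e > 0"
    then obtain z where z: "h x z < g x + e / t"
      using g_approx[of "e / t"] t by auto
    have "g (t *\<^sub>R x) \<le> h (t *\<^sub>R x) (t *\<^sub>R z)" by (rule g_le)
    also have "\<dots> = t * h x z"
      using t fig support_fun_scale_arg[OF fig(2), of t "x - z"]
      by (simp add: h_def support_fun_scale_arg distrib_left scaleR_diff_right)
    also have "\<dots> \<le> t * (g x + e / t)"
      using z t by simp
    finally show "g (t *\<^sub>R x) \<le> t * g x + e"
      using t by (simp add: distrib_left)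
  qed
  have scale: "g (t *\<^sub>R x) = t * g x" if "t \<ge> 0" for t x
  proof (cases "t = 0")
    case True
    have "h 0 0 = 0" using fig by (simp add: h_def)
    then have "g 0 \<le> 0" using g_le[of 0 0] by simp
    moreover have "g 0 \<ge> 0" unfolding g_def by (rule cINF_greatest) (simp_all add: nonneg)
    ultimately show ?thesis using True by simp
  next
    case False
    then have t: "t > 0" using that by simp
    have "g x \<le> inverse t * g (t *\<^sub>R x)"
      using scale_le[of "inverse t" "t *\<^sub>R x"] t by simp
    then have "t * g x \<le> g (t *\<^sub>R x)"
      using t by (simp add: field_simps)
    with scale_le[OF t] show ?thesis by (intro antisym)
  qed
  define W where "W = {s. \<forall>z. s \<bullet> z \<le> g z}"
  have W: "W \<in> convex_figures" "support_fun W = g"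
    using sublinear_support_fun[OF add scale] by (simp_all add: W_def)
  \<comment> \<open>These are the choices \<open>z = x\<close> and \<open>z = 0\<close> in the
    infimum.\<close>
  have "g x \<le> support_fun S x" "g x \<le> support_fun T x" for x
    using g_le[of x x] g_le[of x 0] fig by (simp_all add: h_def)
  then have "W \<subseteq> S \<inter> T"
    using W fig figure_subset_iff by (metis Int_greatest)
  then have "g x \<le> support_fun (S \<inter> T) x"
    using W figure_Int[OF assms(1,2)] figure_subset_iff by metis
  moreover obtain z where "h x z < g x + e" using g_approx assms(3) by blast
  ultimately show ?thesis by (intro that[of z]) (simp add: h_def)
qed

lemma gauge_plus:
  assumes "S \<in> gauges" "T \<in> gauges"
  shows "S + T \<in> gauges"
  using assms figure_plus[OF gauges_figure[OF assms(1)] gauges_figure[OF assms(2)]]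
    support_fun_gauge_nonneg[OF assms(1)] support_fun_gauge_nonneg[OF assms(2)]
  unfolding gauges_iff by (auto simp: add_nonneg_pos add_pos_nonneg)

lemma gauge_scale:
  assumes "S \<in> gauges" "t \<ge> 0"
  shows "(*\<^sub>R) t ` S \<in> gauges"
  using assms figure_scale[OF gauges_figure[OF assms(1)] assms(2)]
  unfolding gauges_iff by (cases "t = 0") auto

lemma gauge_join:
  assumes "S \<in> gauges" "T \<in> gauges"
  shows "join {S, T} \<in> gauges"
  using assms figure_join[OF gauges_figure[OF assms(1)] gauges_figure[OF assms(2)]]
    support_fun_gauge_nonneg[OF assms(1)] support_fun_gauge_nonneg[OF assms(2)]
  unfolding gauges_iff by (auto simp: less_max_iff_disj)

lemma gauge_Int:
  assumes "S \<in> gauges" "T \<in> gauges"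
  shows "S \<inter> T \<in> gauges"
proof (cases "S = {0} \<or> T = {0}")
  case True
  then have "S \<inter> T = {0}" using assms zero_mem_gauge by blast
  then show ?thesis by (simp add: zero_gauge)
next
  case False
  with assms have *: "uminus ` S = S" "uminus ` T = T" "absorbing S" "absorbing T"
    by (auto simp: gauges_def balls_def)
  have "uminus ` (S \<inter> T) = S \<inter> T"
    using * by (simp add: image_Int)
  moreover have "absorbing (S \<inter> T)"
    unfolding absorbing_def
  proof
    fix x
    obtain r q where "r > 0" "q > 0" "\<forall>t. \<bar>t\<bar> \<le> r \<longrightarrow> t *\<^sub>R x \<in> S" "\<forall>t. \<bar>t\<bar> \<le> q \<longrightarrow> t *\<^sub>R x \<in> T"
      using * unfolding absorbing_def by metis
    then show "\<exists>r>0. \<forall>t. \<bar>t\<bar> \<le> r \<longrightarrow> t *\<^sub>R x \<in> S \<inter> T"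
      by (intro exI[of _ "min r q"]) auto
  qed
  ultimately show ?thesis
    using figure_Int[OF assms] by (simp add: gauges_def balls_def)
qed

subsection \<open>Closed gauge cones\<close>

text \<open>Unfolds the Chebyshev metric: closed means stable under uniform limits on the sphere.
  Members of \<open>cfunspace\<close> are extensional, hence the passage between \<open>f\<close>
  and its restriction.\<close>

lemma figures_closed_iff:
  fixes K :: "'a::euclidean_space set set"
  assumes K: "K \<subseteq> convex_figures"
  shows "figures_closed K \<longleftrightarrow>
    (\<forall>f. continuous_on (sphere 0 1) f \<longrightarrow>
      (\<forall>e>0. \<exists>T\<in>K. \<forall>u\<in>sphere 0 1. \<bar>f u - support_fun T u\<bar> < e) \<longrightarrow>
      (\<exists>T\<in>K. \<forall>u\<in>sphere 0 1. f u = support_fun T u))"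
proof -
  let ?S = "sphere (0::'a) 1"
  let ?C = "cfunspace (top_of_set ?S) (euclidean_metric :: real metric)"
  let ?r = "\<lambda>f. restrict f ?S"
  interpret C: Metric_space "mspace ?C" "mdist ?C" by (rule Metric_space_mspace_mdist)
  have "bounded (f ` ?S)" if "continuous_on ?S f" for f :: "'a \<Rightarrow> real"
    using that by (intro compact_imp_bounded compact_continuous_image compact_sphere)
  then have mspace: "f \<in> mspace ?C \<longleftrightarrow> f \<in> extensional ?S \<and> continuous_on ?S f" for f
    by auto
  have r: "?r f \<in> mspace ?C" if "continuous_on ?S f" for f
    using that continuous_on_cong[of ?S ?S "?r f" f] unfolding mspace by auto
  have r_fun: "?r (support_fun T) \<in> mspace ?C" if "T \<in> K" for T
    using that K by (intro r continuous_on_support_fun) auto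
  have approx: "(\<forall>e>0. \<exists>T\<in>K. mdist ?C f (?r (support_fun T)) < e) \<longleftrightarrow>
      (\<forall>e>0. \<exists>T\<in>K. \<forall>u\<in>?S. \<bar>f u - support_fun T u\<bar> < e)" (is "?L \<longleftrightarrow> ?R")
    if f: "f \<in> mspace ?C" for f
  proof (intro iffI allI impI)
    fix e :: real assume ?L "e > 0"
    then obtain T where T: "T \<in> K" "mdist ?C f (?r (support_fun T)) < e" by blast
    have "\<bar>f u - support_fun T u\<bar> < e" if "u \<in> ?S" for u
      using cfunspace_mdist_lt[OF _ f r_fun[OF T(1)] T(2), of u] that
      by (simp add: compactin_subtopology dist_real_def)
    with T(1) show "\<exists>T\<in>K. \<forall>u\<in>?S. \<bar>f u - support_fun T u\<bar> < e" by blast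
  next
    fix e :: real assume ?R "e > 0"
    \<comment> \<open>The distance is a supremum and inherits only a non-strict bound, so half of
      \<open>e\<close> is used.\<close>
    then obtain T where T: "T \<in> K" "\<forall>u\<in>?S. \<bar>f u - support_fun T u\<bar> < e / 2"
      by (meson half_gt_zero)
    have "mdist ?C f (?r (support_fun T)) \<le> e / 2"
      using T \<open>e > 0\<close> by (intro mdist_cfunspace_le) (auto simp: dist_real_def intro: less_imp_le)
    with T(1) \<open>e > 0\<close> show "\<exists>T\<in>K. mdist ?C f (?r (support_fun T)) < e" by force
  qed
  have "figures_closed K \<longleftrightarrow> (\<forall>f\<in>mspace ?C.
      (\<forall>e>0. \<exists>T\<in>K. mdist ?C f (?r (support_fun T)) < e) \<longrightarrow> f \<in> (\<lambda>T. ?r (support_fun T)) ` K)"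
    unfolding figures_closed_def mtopology_of_def closure_of_subset_eq[symmetric]
      C.metric_closure_of C.topspace_mtopology
    using r_fun by (auto simp: C.in_mball image_subset_iff simp del: mspace_cfunspace)
  also have "\<dots> \<longleftrightarrow> (\<forall>f\<in>mspace ?C.
      (\<forall>e>0. \<exists>T\<in>K. \<forall>u\<in>?S. \<bar>f u - support_fun T u\<bar> < e) \<longrightarrow> f \<in> (\<lambda>T. ?r (support_fun T)) ` K)"
    by (intro ball_cong refl) (simp only: approx)
  also have "\<dots> \<longleftrightarrow> (\<forall>f. continuous_on ?S f \<longrightarrow>
      (\<forall>e>0. \<exists>T\<in>K. \<forall>u\<in>?S. \<bar>f u - support_fun T u\<bar> < e) \<longrightarrow>
      (\<exists>T\<in>K. \<forall>u\<in>?S. f u = support_fun T u))" (is "?L \<longleftrightarrow> ?R")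
  proof (intro iffI allI ballI impI)
    fix f assume L: ?L and f: "continuous_on ?S f"
      and a: "\<forall>e>0. \<exists>T\<in>K. \<forall>u\<in>?S. \<bar>f u - support_fun T u\<bar> < e"
    then have "?r f \<in> (\<lambda>T. ?r (support_fun T)) ` K"
      using r[OF f] by simp
    then obtain T where "T \<in> K" "?r f = ?r (support_fun T)" by blast
    then show "\<exists>T\<in>K. \<forall>u\<in>?S. f u = support_fun T u"
      by (metis restrict_apply')
  next
    fix f assume R: ?R and f: "f \<in> mspace ?C"
      and a: "\<forall>e>0. \<exists>T\<in>K. \<forall>u\<in>?S. \<bar>f u - support_fun T u\<bar> < e"
    from f have f': "f \<in> extensional ?S" "continuous_on ?S f" unfolding mspace by auto
    with R a obtain T where T: "T \<in> K" "\<forall>u\<in>?S. f u = support_fun T u" by blast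
    then have "f = ?r (support_fun T)"
      using f'(1) by (intro extensionalityI[of f ?S]) auto
    with T(1) show "f \<in> (\<lambda>T. ?r (support_fun T)) ` K" by blast
  qed
  finally show ?thesis .
qed

lemma closed_gauge_coneD:
  assumes "closed_gauge_cone K"
  shows "S \<in> K \<Longrightarrow> S \<in> gauges"
    and "S \<in> K \<Longrightarrow> T \<in> K \<Longrightarrow> S + T \<in> K"
    and "S \<in> K \<Longrightarrow> t \<ge> 0 \<Longrightarrow> (*\<^sub>R) t ` S \<in> K"
    and "{0} \<in> K"
proof -
  show *: "S \<in> K \<Longrightarrow> t \<ge> 0 \<Longrightarrow> (*\<^sub>R) t ` S \<in> K" "S \<in> K \<Longrightarrow> S \<in> gauges" for S t
    using assms by (auto simp: closed_gauge_cone_def)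
  show "S \<in> K \<Longrightarrow> T \<in> K \<Longrightarrow> S + T \<in> K"
    using assms by (auto simp: closed_gauge_cone_def)
  obtain S where "S \<in> K" using assms by (auto simp: closed_gauge_cone_def)
  moreover from this have "(*\<^sub>R) 0 ` S = {0}"
    using zero_mem_gauge[OF *(2)] by force
  ultimately show "{0} \<in> K" using *(1)[of S 0] by simp
qed

lemma figures_closed_gaugesI:
  fixes K :: "'a::euclidean_space set set"
  assumes "K \<subseteq> gauges"
    and "\<And>f. continuous_on (sphere 0 1) f \<Longrightarrow>
      (\<And>e. e > 0 \<Longrightarrow> \<exists>T\<in>K. \<forall>u\<in>sphere 0 1. \<bar>f u - support_fun T u\<bar> < e) \<Longrightarrow>
      \<exists>T\<in>K. \<forall>u\<in>sphere 0 1. f u = support_fun T u"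
  shows "figures_closed K"
  using assms figures_closed_iff[of K] gauges_figure by blast

lemma closed_gauge_cone_approx:
  fixes K :: "'a::euclidean_space set set"
  assumes "closed_gauge_cone K" "continuous_on (sphere 0 1) f"
    and "\<And>e. e > 0 \<Longrightarrow> \<exists>T\<in>K. \<forall>u\<in>sphere 0 1. \<bar>f u - support_fun T u\<bar> < e"
  shows "\<exists>T\<in>K. \<forall>u\<in>sphere 0 1. f u = support_fun T u"
proof -
  have "K \<subseteq> convex_figures" "figures_closed K"
    using assms(1) gauges_figure by (auto simp: closed_gauge_cone_def)
  then show ?thesis using assms(2,3) figures_closed_iff[of K] by blast
qed

text \<open>A limit is represented in each cone of \<open>F\<close>, and the representatives agree
  because gauges are determined by their values on the sphere.\<close>

lemma closed_gauge_cone_Inter: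
  fixes F :: "'a::euclidean_space set set set"
  assumes "F \<noteq> {}" "\<And>K. K \<in> F \<Longrightarrow> closed_gauge_cone K"
  shows "closed_gauge_cone (\<Inter>F)"
proof -
  obtain K\<^sub>0 where K\<^sub>0: "K\<^sub>0 \<in> F" using assms(1) by blast
  have sub: "\<Inter>F \<subseteq> gauges"
    using K\<^sub>0 assms(2) closed_gauge_coneD(1) by blast
  have "figures_closed (\<Inter>F)"
  proof (rule figures_closed_gaugesI[OF sub])
    fix f :: "'a \<Rightarrow> real"
    assume f: "continuous_on (sphere 0 1) f"
      and a: "\<And>e. e > 0 \<Longrightarrow> \<exists>T\<in>\<Inter>F. \<forall>u\<in>sphere 0 1. \<bar>f u - support_fun T u\<bar> < e"
    have *: "\<exists>T\<in>K. \<forall>u\<in>sphere 0 1. f u = support_fun T u" if "K \<in> F" for K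
      by (rule closed_gauge_cone_approx[OF assms(2)[OF that] f]) (use a that in blast)
    then obtain T where T: "T \<in> K\<^sub>0" "\<forall>u\<in>sphere 0 1. f u = support_fun T u"
      using K\<^sub>0 by blast
    have "T \<in> K" if K: "K \<in> F" for K
    proof -
      obtain U where U: "U \<in> K" "\<forall>u\<in>sphere 0 1. f u = support_fun U u" using * K by blast
      have "T = U"
        using T U K K\<^sub>0 assms(2) by (intro gauge_eqI) (auto intro: closed_gauge_coneD(1))
      with U show ?thesis by simp
    qed
    with T(2) show "\<exists>T\<in>\<Inter>F. \<forall>u\<in>sphere 0 1. f u = support_fun T u" by blast
  qed
  moreover have "{0} \<in> \<Inter>F"
    using assms(2) closed_gauge_coneD(4) by blast
  ultimately show ?thesis
    using sub assms(2) by (auto simp: closed_gauge_cone_def)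
qed

section \<open>Gauges monotone along a relation\<close>

text \<open>The relation is left arbitrary because two are used: one encodes the operator bounds of
  a nondegenerate family, the other is the preorder of a cone.\<close>

definition monotone_gauges :: "('a::euclidean_space \<times> 'a) set \<Rightarrow> 'a set set" where
  "monotone_gauges R = {T \<in> gauges. \<forall>(z, x)\<in>R. support_fun T z \<le> support_fun T x}"

lemma monotone_gaugesI:
  assumes "T \<in> gauges" "\<And>z x. (z, x) \<in> R \<Longrightarrow> support_fun T z \<le> support_fun T x"
  shows "T \<in> monotone_gauges R"
  using assms by (auto simp: monotone_gauges_def)

lemma monotone_gaugesD:
  assumes "T \<in> monotone_gauges R"
  shows "T \<in> gauges" "(z, x) \<in> R \<Longrightarrow> support_fun T z \<le> support_fun T x"
  using assms by (auto simp: monotone_gauges_def)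

lemma le_if_le_add_epsilon_mult:
  fixes a b c :: real
  assumes "\<And>e. e > 0 \<Longrightarrow> a \<le> b + e * c"
  shows "a \<le> b"
proof (rule field_le_epsilon)
  fix e :: real assume "e > 0"
  have "a \<le> b + e / (\<bar>c\<bar> + 1) * c"
    using \<open>e > 0\<close> by (intro assms) (auto intro!: divide_pos_pos add_nonneg_pos)
  also have "e / (\<bar>c\<bar> + 1) * c \<le> e / (\<bar>c\<bar> + 1) * (\<bar>c\<bar> + 1)"
    using \<open>e > 0\<close> by (intro mult_left_mono) auto
  also have "\<dots> = e" by (simp add: add_nonneg_eq_0_iff)
  finally show "a \<le> b + e" by simp
qed

text \<open>The absorption hypothesis keeps limits of monotone balls from degenerating to
  non-absorbing figures other than \<open>{0}\<close>.\<close>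

lemma closed_gauge_cone_monotone_gauges:
  fixes R :: "('a::euclidean_space \<times> 'a) set"
  assumes absorb: "\<And>y z. y \<noteq> 0 \<Longrightarrow> \<exists>c\<ge>0. (z, c *\<^sub>R y) \<in> R"
  shows "closed_gauge_cone (monotone_gauges R)"
proof -
  let ?G = "monotone_gauges R"
  have sub: "?G \<subseteq> gauges" by (auto simp: monotone_gauges_def)
  have "figures_closed ?G"
  proof (rule figures_closed_gaugesI[OF sub])
    fix f :: "'a \<Rightarrow> real"
    assume a: "\<And>e. e > 0 \<Longrightarrow> \<exists>T\<in>?G. \<forall>u\<in>sphere 0 1. \<bar>f u - support_fun T u\<bar> < e"
    \<comment> \<open>The homogeneous extension of the limit \<open>f\<close> to the whole space,
      with \<open>F 0 = 0\<close>.\<close>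
    define F where "F x = norm x * f (x /\<^sub>R norm x)" for x
    have F: "\<exists>T\<in>?G. \<forall>x. \<bar>F x - support_fun T x\<bar> \<le> e * norm x" if e: "e > 0" for e
    proof -
      obtain T where T: "T \<in> ?G" "\<forall>u\<in>sphere 0 1. \<bar>f u - support_fun T u\<bar> < e"
        using a[OF e] by blast
      have "\<bar>F x - support_fun T x\<bar> \<le> e * norm x" for x
      proof (cases "x = 0")
        case False
        then have "\<bar>f (x /\<^sub>R norm x) - support_fun T (x /\<^sub>R norm x)\<bar> < e"
          using T by simp
        moreover have "support_fun T x = norm x * support_fun T (x /\<^sub>R norm x)"
          using T(1) by (intro support_fun_normalize gauges_figure monotone_gaugesD)
        then have "F x - support_fun T x = norm x * (f (x /\<^sub>R norm x) - support_fun T (x /\<^sub>R norm x))"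
          by (simp add: F_def right_diff_distrib)
        ultimately show ?thesis
          using False by (simp add: abs_mult mult.commute)
      qed (simp add: F_def gauges_figure monotone_gaugesD(1)[OF T(1)])
      with T(1) show ?thesis by blast
    qed
    have bound: "F z \<le> F x" if "(z, x) \<in> R" for z x
    proof (rule le_if_le_add_epsilon_mult[where c = "norm z + norm x"])
      fix e :: real assume "e > 0"
      then obtain T where T: "T \<in> ?G" "\<forall>x. \<bar>F x - support_fun T x\<bar> \<le> e * norm x" using F by blast
      show "F z \<le> F x + e * (norm z + norm x)"
        using monotone_gaugesD(2)[OF T(1) that] T(2)[rule_format, of x] T(2)[rule_format, of z]
        by (simp add: distrib_left abs_le_iff)
    qed
    have add: "F (x + y) \<le> F x + F y" for x y
    proof (rule le_if_le_add_epsilon_mult[where c = "norm (x + y) + norm x + norm y"])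
      fix e :: real assume "e > 0"
      then obtain T where T: "T \<in> ?G" "\<forall>x. \<bar>F x - support_fun T x\<bar> \<le> e * norm x" using F by blast
      show "F (x + y) \<le> F x + F y + e * (norm (x + y) + norm x + norm y)"
        using support_fun_add_arg[OF gauges_figure[OF monotone_gaugesD(1)[OF T(1)]], of x y]
          T(2)[rule_format, of x] T(2)[rule_format, of y] T(2)[rule_format, of "x + y"]
        by (simp add: distrib_left abs_le_iff)
    qed
    have even_le: "F (- x) \<le> F x" for x
    proof (rule le_if_le_add_epsilon_mult[where c = "norm x + norm x"])
      fix e :: real assume "e > 0"
      then obtain T where T: "T \<in> ?G" "\<forall>x. \<bar>F x - support_fun T x\<bar> \<le> e * norm x" using F by blast
      then have "support_fun T (- x) = support_fun T x"
        using monotone_gaugesD(1)[OF T(1)] by (simp add: gauges_iff)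
      then show "F (- x) \<le> F x + e * (norm x + norm x)"
        using T(2)[rule_format, of x] T(2)[rule_format, of "- x"]
        by (simp add: distrib_left abs_le_iff)
    qed
    have nonneg: "0 \<le> F x" for x
      using add[of x "- x"] even_le[of x] by (simp add: F_def)
    have scale: "F (t *\<^sub>R x) = t * F x" if "t \<ge> 0" for t x
    proof (cases "t = 0")
      case False
      then have "inverse (norm (t *\<^sub>R x)) * t = inverse (norm x)"
        using that by (simp add: field_simps)
      then have "(t *\<^sub>R x) /\<^sub>R norm (t *\<^sub>R x) = x /\<^sub>R norm x"
        by (simp only: scaleR_scaleR)
      then show ?thesis using that by (simp only: F_def) simp
    qed (simp add: F_def)
    define W where "W = {s. \<forall>z. s \<bullet> z \<le> F z}"
    have W: "W \<in> convex_figures" "support_fun W = F"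
      using sublinear_support_fun[OF add scale] by (simp_all add: W_def)
    \<comment> \<open>If \<open>F\<close> vanishes at some \<open>y \<noteq> 0\<close>, absorption
      gives \<open>F z \<le> c * F y \<le> 0\<close> for every \<open>z\<close>, so \<open>F\<close>
      vanishes everywhere.\<close>
    have "(\<forall>z. F z = 0) \<or> (\<forall>z. z \<noteq> 0 \<longrightarrow> F z > 0)"
    proof (rule ccontr)
      assume "\<not> ?thesis"
      then obtain z y where zy: "F z \<noteq> 0" "y \<noteq> 0" "\<not> F y > 0" by blast
      then obtain c where "c \<ge> 0" "(z, c *\<^sub>R y) \<in> R" using absorb by blast
      then have "F z \<le> c * F y" using bound scale by metis
      with zy nonneg[of z] nonneg[of y] \<open>c \<ge> 0\<close> show False
        by (simp add: order_antisym_conv)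
    qed
    moreover have "F (- x) = F x" for x
      using even_le[of x] even_le[of "- x"] by simp
    ultimately have "W \<in> gauges" using W by (simp add: gauges_iff)
    then have "W \<in> ?G" using W bound by (auto simp: monotone_gauges_def)
    moreover have "\<forall>u\<in>sphere 0 1. f u = support_fun W u" by (simp add: W F_def)
    ultimately show "\<exists>T\<in>?G. \<forall>u\<in>sphere 0 1. f u = support_fun T u" by blast
  qed
  moreover have "{0} \<in> ?G" by (auto intro: monotone_gaugesI zero_gauge)
  moreover have "S + T \<in> ?G" if "S \<in> ?G" "T \<in> ?G" for S T
    using that by (auto simp: monotone_gauges_def gauge_plus figure_plus gauges_figure split_beta
        intro!: add_mono)
  moreover have "(*\<^sub>R) t ` S \<in> ?G" if "S \<in> ?G" "t \<ge> 0" for S t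
    using that by (auto simp: monotone_gauges_def gauge_scale figure_scale gauges_figure split_beta
        intro!: mult_left_mono)
  ultimately show ?thesis
    using sub by (auto simp: closed_gauge_cone_def)
qed

lemma join_closed_monotone_gauges: "join_closed (monotone_gauges R)"
  unfolding join_closed_def
  by (fastforce simp: monotone_gauges_def gauge_join figure_join gauges_figure)

text \<open>A splitting of \<open>x\<close> that is nearly optimal in the convolution formula is
  carried by \<open>decomp\<close> to a splitting of \<open>z\<close> that costs no more.\<close>

lemma meet_closed_monotone_gauges:
  fixes R :: "('a::euclidean_space \<times> 'a) set"
  assumes decomp: "\<And>z x y. (z, x + y) \<in> R \<Longrightarrow> \<exists>w. (w, x) \<in> R \<and> (z - w, y) \<in> R"
  shows "meet_closed (monotone_gauges R)"
  unfolding meet_closed_def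
proof (intro ballI monotone_gaugesI gauge_Int)
  fix S T assume S: "S \<in> monotone_gauges R" and T: "T \<in> monotone_gauges R"
  note gauges = monotone_gaugesD(1)[OF S] monotone_gaugesD(1)[OF T]
  show "S \<in> gauges" "T \<in> gauges" by (fact gauges)+
  fix z x assume R: "(z, x) \<in> R"
  show "support_fun (S \<inter> T) z \<le> support_fun (S \<inter> T) x"
  proof (rule field_le_epsilon)
    fix e :: real assume "e > 0"
    then obtain y where y: "support_fun S y + support_fun T (x - y) < support_fun (S \<inter> T) x + e"
      using support_fun_Int_approx gauges by blast
    have "(z, y + (x - y)) \<in> R" using R by simp
    then obtain w where "(w, y) \<in> R" "(z - w, x - y) \<in> R" using decomp by blast
    then have "support_fun S w + support_fun T (z - w) \<le> support_fun S y + support_fun T (x - y)"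
      by (intro add_mono monotone_gaugesD(2)[OF S] monotone_gaugesD(2)[OF T])
    moreover have "support_fun (S \<inter> T) z \<le> support_fun S w + support_fun T (z - w)"
      using support_fun_Int_le[OF gauges, of w "z - w"] by simp
    ultimately show "support_fun (S \<inter> T) z \<le> support_fun (S \<inter> T) x + e"
      using y by linarith
  qed
qed

subsection \<open>Nondegenerate families\<close>

text \<open>A norm below \<open>c\<close> puts \<open>x\<close> into a multiple of \<open>S\<close>
  by a factor less than \<open>c\<close>. Absorption makes the set of factors nonempty, so its
  \<open>Inf\<close> is a genuine infimum.\<close>

lemma ball_norm_less_imp:
  assumes S: "S \<in> balls" and less: "ball_norm S x < c"
  shows "x \<bullet> z \<le> c * support_fun S z"
proof -
  have gauge: "S \<in> gauges" using S by (simp add: gauges_def)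
  obtain r where r: "r > 0" "r *\<^sub>R x \<in> S"
    using S absorbingE unfolding balls_def by blast
  then have "inverse r \<in> {\<alpha>. \<alpha> > 0 \<and> x /\<^sub>R \<alpha> \<in> S}" by simp
  then have "{\<alpha>. \<alpha> > 0 \<and> x /\<^sub>R \<alpha> \<in> S} \<noteq> {}" by blast
  from cInf_lessD[OF this less[unfolded ball_norm_def]]
  obtain \<alpha> where \<alpha>: "\<alpha> > 0" "x /\<^sub>R \<alpha> \<in> S" "\<alpha> < c" by blast
  have "inverse \<alpha> * (x \<bullet> z) \<le> support_fun S z"
    using inner_le_support_fun[OF gauges_figure[OF gauge] \<alpha>(2), of z] by simp
  then have "x \<bullet> z \<le> \<alpha> * support_fun S z"
    using \<alpha>(1) by (simp add: field_simps)
  also have "\<dots> \<le> c * support_fun S z"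
    using \<alpha>(3) support_fun_gauge_nonneg[OF gauge] by (intro mult_right_mono) auto
  finally show ?thesis .
qed

text \<open>The \<open>SUP\<close> in \<open>ball_onorm\<close> runs over a bounded set, because
  \<open>S\<close> lies between the Euclidean balls of radii \<open>r\<close> and
  \<open>C\<close>.\<close>

lemma ball_norm_le_ball_onorm:
  fixes S :: "'a::euclidean_space set"
  assumes S: "S \<in> balls" and A: "linear A" and s: "s \<in> S"
  shows "ball_norm S (A s) \<le> ball_onorm S A"
proof -
  have gauge: "S \<in> gauges" "absorbing S" using S by (auto simp: gauges_def balls_def)
  note fig = gauges_figure[OF gauge(1)]
  have "S \<noteq> {0}"
  proof
    assume "S = {0}"
    moreover obtain b :: 'a where "b \<noteq> 0" using nonzero_Basis SOME_Basis by blast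
    moreover obtain r where "r > 0" "r *\<^sub>R b \<in> S" using gauge(2) by (rule absorbingE)
    ultimately show False by simp
  qed
  then obtain r where r: "r > 0" "\<And>z. r * norm z \<le> support_fun S z"
    using support_fun_lower_bound[OF fig] support_fun_gauge_pos[OF gauge(1)] by blast
  obtain B where B: "B > 0" "\<And>x. norm (A x) \<le> B * norm x"
    using linear_bounded_pos[OF A] by blast
  obtain C where C: "C > 0" "\<And>x. x \<in> S \<Longrightarrow> norm x \<le> C"
    using convex_figuresD(5)[OF fig] unfolding bounded_pos by blast
  have "ball_norm S (A x) \<le> B * C / r" if x: "x \<in> S" for x
  proof -
    let ?\<alpha> = "B * C / r"
    have \<alpha>: "?\<alpha> > 0" using B C r by simp
    have "A x /\<^sub>R ?\<alpha> \<in> S"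
      unfolding mem_figure_iff[OF fig]
    proof
      fix z
      have "(A x /\<^sub>R ?\<alpha>) \<bullet> z \<le> norm (A x /\<^sub>R ?\<alpha>) * norm z" by (rule norm_cauchy_schwarz)
      also have "norm (A x /\<^sub>R ?\<alpha>) \<le> r"
      proof -
        have "norm (A x) \<le> B * C"
          using B(2)[of x] C(2)[OF x] B(1) by (meson mult_left_mono less_imp_le order_trans)
        then show ?thesis using B(1) C(1) r(1) by (simp add: field_simps)
      qed
      finally show "(A x /\<^sub>R ?\<alpha>) \<bullet> z \<le> support_fun S z"
        using r(2)[of z] by (meson mult_right_mono norm_ge_zero order_trans)
    qed
    then show ?thesis
      unfolding ball_norm_def using \<alpha> by (intro cInf_lower bdd_belowI[of _ 0]) auto
  qed
  then have "bdd_above ((\<lambda>x. ball_norm S (A x)) ` S)" by (intro bdd_aboveI2)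
  then show ?thesis
    unfolding ball_onorm_def using s by (rule cSUP_upper[rotated])
qed

text \<open>Nondegeneracy says that \<open>A\<close> maps each ball of the family into a fixed
  multiple of itself; passing to support functions moves \<open>A\<close> to its adjoint.\<close>

lemma nondegenerate_adjoint_bound:
  assumes nd: "nondegenerate \<Xi> S" and A: "linear A"
  shows "\<exists>c>0. \<forall>\<xi>\<in>\<Xi>. \<forall>z. support_fun (S \<xi>) (adjoint A z) \<le> c * support_fun (S \<xi>) z"
proof -
  have "bdd_above ((\<lambda>\<xi>. ball_onorm (S \<xi>) A) ` \<Xi>)"
    using nd A by (simp add: nondegenerate_def)
  then obtain C where C: "\<And>\<xi>. \<xi> \<in> \<Xi> \<Longrightarrow> ball_onorm (S \<xi>) A \<le> C"
    unfolding bdd_above_def by blast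
  \<comment> \<open>The factor is positive and strictly above all the norms, as
    \<open>ball_norm_less_imp\<close> requires.\<close>
  have "support_fun (S \<xi>) (adjoint A z) \<le> (\<bar>C\<bar> + 1) * support_fun (S \<xi>) z" if \<xi>: "\<xi> \<in> \<Xi>" for \<xi> z
  proof (rule support_fun_le)
    have ball: "S \<xi> \<in> balls" using nd \<xi> by (simp add: nondegenerate_def)
    then show "S \<xi> \<in> convex_figures" by (simp add: balls_def)
    fix s assume s: "s \<in> S \<xi>"
    have "ball_norm (S \<xi>) (A s) < \<bar>C\<bar> + 1"
      using ball_norm_le_ball_onorm[OF ball A s] C[OF \<xi>] by linarith
    from ball_norm_less_imp[OF ball this]
    show "s \<bullet> adjoint A z \<le> (\<bar>C\<bar> + 1) * support_fun (S \<xi>) z"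
      by (simp add: adjoint_works[OF A])
  qed
  then show ?thesis by (intro exI[of _ "\<bar>C\<bar> + 1"]) (auto intro: add_nonneg_pos)
qed

text \<open>A rank-one map suffices. With the adjoint bounds, this compares every \<open>z\<close>
  with every nonzero \<open>y\<close> uniformly over the family.\<close>

lemma linear_adjoint_transitive:
  fixes y z :: "'a::euclidean_space"
  assumes "y \<noteq> 0"
  obtains A :: "'a \<Rightarrow> 'a" where "linear A" "adjoint A y = z"
proof
  let ?A = "\<lambda>s. (s \<bullet> z / (y \<bullet> y)) *\<^sub>R y"
  show "linear ?A"
    by (auto intro!: linearI simp: inner_add_left add_divide_distrib scaleR_add_left)
  have "adjoint ?A = (\<lambda>v. ((v \<bullet> y) / (y \<bullet> y)) *\<^sub>R z)"
    by (rule adjoint_unique) (simp add: inner_commute)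
  then show "adjoint ?A y = z" using assms by simp
qed

text \<open>The hull inherits the properties of a closed cone once at least one suitable cone
  contains the family. The gauges obeying the adjoint bounds of the family form such a cone, and the
  third claim follows because the hull lies in it.\<close>

lemma nondegenerate_lower_hull:
  fixes S :: "'i \<Rightarrow> 'a::euclidean_space set"
  assumes nd: "nondegenerate \<Xi> S"
  shows "closed_gauge_cone (lower_hull (S ` \<Xi>))" "meet_closed (lower_hull (S ` \<Xi>))"
    and "y \<noteq> 0 \<Longrightarrow> \<exists>c\<ge>0. \<forall>h\<in>lower_hull (S ` \<Xi>). support_fun h z \<le> support_fun h (c *\<^sub>R y)"
proof -
  have "\<forall>A. \<exists>c. linear A \<longrightarrow> c > 0 \<and>
      (\<forall>\<xi>\<in>\<Xi>. \<forall>z. support_fun (S \<xi>) (adjoint A z) \<le> c * support_fun (S \<xi>) z)"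
    using nondegenerate_adjoint_bound[OF nd] by blast
  then obtain c where c: "\<And>A. linear A \<Longrightarrow> c A > 0"
    "\<And>A \<xi> z. linear A \<Longrightarrow> \<xi> \<in> \<Xi> \<Longrightarrow> support_fun (S \<xi>) (adjoint A z) \<le> c A * support_fun (S \<xi>) z"
    by metis
  \<comment> \<open>Monotonicity along \<open>R\<close> is exactly the family of adjoint bounds,
    with the factor moved into the argument.\<close>
  define R where "R = {(adjoint A x, c A *\<^sub>R x) |A x. linear A}"
  have R_I: "(adjoint A x, c A *\<^sub>R x) \<in> R" if "linear A" for A x
    unfolding R_def by (rule CollectI, rule exI[of _ A], rule exI[of _ x], rule conjI[OF refl that])
  let ?G = "monotone_gauges R"
  have absorb: "\<exists>c\<ge>0. (z, c *\<^sub>R y) \<in> R" if y: "y \<noteq> 0" for y z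
  proof -
    obtain A :: "'a \<Rightarrow> 'a" where A: "linear A" "adjoint A y = z"
      by (rule linear_adjoint_transitive[OF y])
    then show ?thesis using R_I[OF A(1), of y] c(1)[OF A(1)] by (intro exI[of _ "c A"]) simp
  qed
  then have G: "closed_gauge_cone ?G" by (rule closed_gauge_cone_monotone_gauges)
  \<comment> \<open>The decomposition is explicit here: the linear map \<open>adjoint A\<close> is
    applied to the two summands of \<open>v\<close>.\<close>
  have "\<exists>w. (w, x) \<in> R \<and> (z - w, y) \<in> R" if R: "(z, x + y) \<in> R" for z x y
  proof -
    obtain A v where A: "linear A" "z = adjoint A v" "x + y = c A *\<^sub>R v"
      using R by (auto simp: R_def)
    have lin: "linear (adjoint A)" using A(1) by (rule adjoint_linear)
    have cA: "c A \<noteq> 0" using c(1)[OF A(1)] by simp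
    let ?w = "adjoint A (x /\<^sub>R c A)"
    have "(?w, c A *\<^sub>R (x /\<^sub>R c A)) \<in> R" "(adjoint A (y /\<^sub>R c A), c A *\<^sub>R (y /\<^sub>R c A)) \<in> R"
      using A(1) by (rule R_I)+
    moreover have "v = x /\<^sub>R c A + y /\<^sub>R c A"
      using A(3) cA by (simp add: scaleR_add_right[symmetric])
    then have "z - ?w = adjoint A (y /\<^sub>R c A)"
      using A(2) lin by (simp add: linear_add)
    ultimately show ?thesis using cA by auto
  qed
  then have meet: "meet_closed ?G" by (rule meet_closed_monotone_gauges)
  have "S \<xi> \<in> ?G" if \<xi>: "\<xi> \<in> \<Xi>" for \<xi>
  proof (rule monotone_gaugesI)
    show gauge: "S \<xi> \<in> gauges" using nd \<xi> by (simp add: nondegenerate_def gauges_def)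
    fix z x assume "(z, x) \<in> R"
    then show "support_fun (S \<xi>) z \<le> support_fun (S \<xi>) x"
      using c \<xi> by (auto simp: R_def support_fun_scale_arg gauges_figure[OF gauge] less_imp_le)
  qed
  then have sub: "S ` \<Xi> \<subseteq> ?G" by blast
  let ?F = "{K. (closed_gauge_cone K \<and> meet_closed K) \<and> S ` \<Xi> \<subseteq> K}"
  have eq: "lower_hull (S ` \<Xi>) = \<Inter>?F" by (simp add: lower_hull_def hull_def)
  have "?G \<in> ?F" using G meet sub by simp
  then show "closed_gauge_cone (lower_hull (S ` \<Xi>))"
    unfolding eq by (intro closed_gauge_cone_Inter) auto
  show "meet_closed (lower_hull (S ` \<Xi>))"
    unfolding eq by (auto simp: meet_closed_def)
  have "lower_hull (S ` \<Xi>) \<subseteq> ?G"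
    unfolding lower_hull_def using sub G meet by (intro hull_minimal) auto
  then show "\<exists>c\<ge>0. \<forall>h\<in>lower_hull (S ` \<Xi>). support_fun h z \<le> support_fun h (c *\<^sub>R y)" if "y \<noteq> 0"
    using absorb[OF that, of z] monotone_gaugesD(2) by blast
qed

subsection \<open>A theorem of the alternative\<close>

text \<open>The points lying above some value of the pair \<open>(f, g)\<close> form a convex set
  that misses the open negative quadrant; a separating functional has nonnegative coefficients, and
  these are normalized to sum 1.\<close>

lemma convexlike_alternative_two:
  fixes f g :: "'x \<Rightarrow> real"
  assumes conv: "\<And>x y t. x \<in> X \<Longrightarrow> y \<in> X \<Longrightarrow> 0 \<le> t \<Longrightarrow> t \<le> 1 \<Longrightarrow>
      \<exists>w\<in>X. f w \<le> (1 - t) * f x + t * f y \<and> g w \<le> (1 - t) * g x + t * g y"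
    and none: "\<And>x. x \<in> X \<Longrightarrow> 0 \<le> f x \<or> 0 \<le> g x"
  obtains m where "0 \<le> m" "m \<le> 1" "\<And>x. x \<in> X \<Longrightarrow> 0 \<le> (1 - m) * f x + m * g x"
proof (cases "X = {}")
  case True
  then show ?thesis by (intro that[of 0]) auto
next
  case False
  let ?C = "{(a, b). \<exists>x\<in>X. f x \<le> a \<and> g x \<le> b}" and ?D = "{..<0::real} \<times> {..<0::real}"
  have "convex ?C"
    unfolding convex_alt
  proof (clarsimp)
    fix a b c d t x y
    assume *: "0 \<le> t" "t \<le> (1::real)" "x \<in> X" "y \<in> X" "f x \<le> a" "g x \<le> b" "f y \<le> c" "g y \<le> d"
    obtain w where w: "w \<in> X" "f w \<le> (1 - t) * f x + t * f y" "g w \<le> (1 - t) * g x + t * g y"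
      using conv * by blast
    have "(1 - t) * f x + t * f y \<le> (1 - t) * a + t * c" "(1 - t) * g x + t * g y \<le> (1 - t) * b + t * d"
      using * by (auto intro!: add_mono mult_left_mono)
    with w show "\<exists>w\<in>X. f w \<le> (1 - t) * a + t * c \<and> g w \<le> (1 - t) * b + t * d"
      by (meson order_trans)
  qed
  moreover have "convex ?D" by (intro convex_Times) auto
  moreover have "(-1, -1) \<in> ?D" by simp
  then have "?D \<noteq> {}" by blast
  moreover obtain x where "x \<in> X" using False by blast
  then have "(f x, g x) \<in> ?C" by blast
  then have "?C \<noteq> {}" by blast
  moreover have "?D \<inter> ?C = {}"
    using none by fastforce
  ultimately obtain v k where v: "v \<noteq> 0" "\<And>x. x \<in> ?D \<Longrightarrow> v \<bullet> x \<le> k" "\<And>x. x \<in> ?C \<Longrightarrow> k \<le> v \<bullet> x"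
    using separating_hyperplane_sets[of ?D ?C] by blast
  obtain p q where pq: "v = (p, q)" by (cases v)
  have D: "p * a + q * b \<le> k" if "a < 0" "b < 0" for a b
    using v(2)[of "(a, b)"] that by (simp add: pq)
  \<comment> \<open>With \<open>p < 0\<close>, a very negative \<open>a\<close> pushes the
    functional above \<open>k\<close>; the chosen \<open>a\<close> makes \<open>p * a\<close> equal
    to \<open>\<bar>k\<bar> + \<bar>q\<bar> + 1\<close>.\<close>
  have nonneg: "p \<ge> 0" if D: "\<And>a b. a < 0 \<Longrightarrow> b < 0 \<Longrightarrow> p * a + q * b \<le> k" for p q
  proof (rule ccontr)
    assume neg: "\<not> p \<ge> 0"
    let ?n = "(\<bar>k\<bar> + \<bar>q\<bar> + 1) / p"
    have "?n < 0" using neg by (intro divide_pos_neg) auto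
    from D[OF this, of "-1"] neg show False by simp
  qed
  have "p \<ge> 0" by (rule nonneg[OF D])
  moreover have "q \<ge> 0" by (rule nonneg[of q p]) (use D in \<open>auto simp: add.commute\<close>)
  ultimately have pos: "p + q > 0" using v(1) by (auto simp: pq add_nonneg_eq_0_iff less_le zero_prod_def)
  \<comment> \<open>Points of the quadrant approach the origin along the diagonal.\<close>
  have "0 \<le> k"
  proof (rule le_if_le_add_epsilon_mult)
    fix e :: real assume "e > 0"
    then show "0 \<le> k + e * (p + q)" using D[of "- e" "- e"] by (simp add: algebra_simps)
  qed
  show ?thesis
  proof (rule that[of "q / (p + q)"])
    show "0 \<le> q / (p + q)" "q / (p + q) \<le> 1" using \<open>p \<ge> 0\<close> \<open>q \<ge> 0\<close> pos by auto
    fix x assume "x \<in> X"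
    then have "k \<le> p * f x + q * g x" using v(3)[of "(f x, g x)"] by (auto simp: pq)
    with \<open>0 \<le> k\<close> have "0 \<le> (p * f x + q * g x) / (p + q)" using pos by simp
    moreover have "1 - q / (p + q) = p / (p + q)" using pos by (simp add: field_simps)
    ultimately show "0 \<le> (1 - q / (p + q)) * f x + q / (p + q) * g x"
      by (simp add: add_divide_distrib)
  qed
qed

text \<open>The Fan--Glicksberg--Hoffman theorem of the alternative. In the induction step, the
  hypothesis is applied on the set where the newly added function is negative.\<close>

lemma convexlike_alternative:
  fixes f :: "'i \<Rightarrow> 'x \<Rightarrow> real"
  assumes "finite I" "I \<noteq> {}"
    and "\<And>x y t. x \<in> X \<Longrightarrow> y \<in> X \<Longrightarrow> 0 \<le> t \<Longrightarrow> t \<le> 1 \<Longrightarrow>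
      \<exists>w\<in>X. \<forall>i\<in>I. f i w \<le> (1 - t) * f i x + t * f i y"
    and "\<And>x. x \<in> X \<Longrightarrow> \<exists>i\<in>I. 0 \<le> f i x"
  shows "\<exists>l. (\<forall>i\<in>I. 0 \<le> l i) \<and> sum l I = 1 \<and> (\<forall>x\<in>X. 0 \<le> (\<Sum>i\<in>I. l i * f i x))"
  using assms
proof (induction I arbitrary: X rule: finite_ne_induct)
  case (singleton i)
  then show ?case by (intro exI[of _ "\<lambda>_. 1"]) auto
next
  case (insert j I)
  note conv = insert.prems(1) and none = insert.prems(2)
  let ?X = "{x\<in>X. f j x < 0}"
  have "\<exists>l. (\<forall>i\<in>I. 0 \<le> l i) \<and> sum l I = 1 \<and> (\<forall>x\<in>?X. 0 \<le> (\<Sum>i\<in>I. l i * f i x))"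
  proof (rule insert.IH)
    fix x y :: 'x and t :: real
    assume *: "x \<in> ?X" "y \<in> ?X" "0 \<le> t" "t \<le> 1"
    then obtain w where w: "w \<in> X" "\<forall>i\<in>insert j I. f i w \<le> (1 - t) * f i x + t * f i y"
      using conv by blast
    \<comment> \<open>This keeps the convexity witness \<open>w\<close> inside the smaller set
      \<open>?X\<close>.\<close>
    have "(1 - t) * f j x + t * f j y < 0"
      using * by (cases "t = 0") (auto intro!: add_nonpos_neg mult_pos_neg mult_nonneg_nonpos)
    with w show "\<exists>w\<in>?X. \<forall>i\<in>I. f i w \<le> (1 - t) * f i x + t * f i y" by force
  next
    fix x assume "x \<in> ?X"
    then show "\<exists>i\<in>I. 0 \<le> f i x" using none[of x] by auto
  qed
  then obtain l where l: "\<And>i. i \<in> I \<Longrightarrow> 0 \<le> l i" "sum l I = 1"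
    "\<And>x. x \<in> X \<Longrightarrow> f j x < 0 \<Longrightarrow> 0 \<le> (\<Sum>i\<in>I. l i * f i x)" by blast
  let ?g = "\<lambda>x. \<Sum>i\<in>I. l i * f i x"
  have "\<exists>w\<in>X. ?g w \<le> (1 - t) * ?g x + t * ?g y \<and> f j w \<le> (1 - t) * f j x + t * f j y"
    if "x \<in> X" "y \<in> X" "0 \<le> t" "t \<le> 1" for x y t
  proof -
    obtain w where w: "w \<in> X" "\<forall>i\<in>insert j I. f i w \<le> (1 - t) * f i x + t * f i y"
      using conv \<open>x \<in> X\<close> \<open>y \<in> X\<close> \<open>0 \<le> t\<close> \<open>t \<le> 1\<close> by blast
    then have "?g w \<le> (\<Sum>i\<in>I. l i * ((1 - t) * f i x + t * f i y))"
      by (intro sum_mono mult_left_mono l) auto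
    also have "\<dots> = (1 - t) * ?g x + t * ?g y"
      by (simp add: sum_distrib_left sum.distrib[symmetric] algebra_simps)
    finally show ?thesis using w by blast
  qed
  \<comment> \<open>Where \<open>f j\<close> is negative, the induction hypothesis makes
    \<open>?g\<close> nonnegative, so the case of two functions applies to \<open>?g\<close> and
    \<open>f j\<close>.\<close>
  moreover have "0 \<le> ?g x \<or> 0 \<le> f j x" if "x \<in> X" for x
    using l(3)[OF that] by linarith
  ultimately obtain m where m: "0 \<le> m" "m \<le> 1" "\<And>x. x \<in> X \<Longrightarrow> 0 \<le> (1 - m) * ?g x + m * f j x"
    using convexlike_alternative_two[of X ?g "f j"] by blast
  let ?l = "\<lambda>i. if i = j then m else (1 - m) * l i"
  have sum: "(\<Sum>i\<in>insert j I. ?l i * h i) = m * h j + (1 - m) * (\<Sum>i\<in>I. l i * h i)" for h :: "'i \<Rightarrow> real"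
  proof -
    have "(\<Sum>i\<in>insert j I. ?l i * h i) = m * h j + (\<Sum>i\<in>I. ?l i * h i)"
      using insert.hyps by simp
    also have "(\<Sum>i\<in>I. ?l i * h i) = (\<Sum>i\<in>I. (1 - m) * (l i * h i))"
      using insert.hyps by (intro sum.cong) auto
    finally show ?thesis by (simp add: sum_distrib_left)
  qed
  show ?case
  proof (intro exI[of _ ?l] conjI ballI)
    show "0 \<le> ?l i" if "i \<in> insert j I" for i using that l m by auto
    show "sum ?l (insert j I) = 1" using sum[of "\<lambda>_. 1"] l(2) by simp
    show "0 \<le> (\<Sum>i\<in>insert j I. ?l i * f i x)" if "x \<in> X" for x
      using m(3)[OF that] unfolding sum by simp
  qed
qed

subsection \<open>Riesz decomposition\<close>

text \<open>Covers both evaluations of support functions at a point and finite sums of these; the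
  sums are needed to iterate the decomposition.\<close>

definition additive_functional :: "'a::euclidean_space set set \<Rightarrow> ('a set \<Rightarrow> real) \<Rightarrow> bool" where
  "additive_functional K p \<longleftrightarrow>
     (\<forall>S\<in>K. \<forall>T\<in>K. p (S + T) = p S + p T) \<and>
     (\<forall>S\<in>K. \<forall>t\<ge>0. p ((*\<^sub>R) t ` S) = t * p S) \<and>
     (\<forall>S\<in>K. \<forall>T\<in>K. S \<subseteq> T \<longrightarrow> p S \<le> p T)"

lemma additive_functionalD:
  assumes "additive_functional K p"
  shows "S \<in> K \<Longrightarrow> T \<in> K \<Longrightarrow> p (S + T) = p S + p T"
    and "S \<in> K \<Longrightarrow> t \<ge> 0 \<Longrightarrow> p ((*\<^sub>R) t ` S) = t * p S"
    and "S \<in> K \<Longrightarrow> T \<in> K \<Longrightarrow> S \<subseteq> T \<Longrightarrow> p S \<le> p T"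
  using assms by (auto simp: additive_functional_def)

lemma additive_functional_zero:
  assumes "closed_gauge_cone K" "additive_functional K p"
  shows "p {0} = 0"
  using additive_functionalD(2)[OF assms(2) closed_gauge_coneD(4)[OF assms(1)], of 0] by simp

lemma additive_functional_support_fun:
  assumes "closed_gauge_cone K"
  shows "additive_functional K (\<lambda>S. support_fun S z)"
proof -
  have fig: "S \<in> convex_figures" if "S \<in> K" for S
    using closed_gauge_coneD(1)[OF assms that] by (rule gauges_figure)
  show ?thesis
    unfolding additive_functional_def
    by (intro conjI ballI allI impI) (simp_all add: figure_plus figure_scale figure_subset_iff fig)
qed

lemma additive_functional_sum:
  assumes "\<And>i. i \<in> I \<Longrightarrow> additive_functional K (p i)"
  shows "additive_functional K (\<lambda>S. \<Sum>i\<in>I. p i S)"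
  using additive_functionalD[OF assms]
  by (auto simp: additive_functional_def sum.distrib sum_distrib_left intro!: sum_mono)

text \<open>One member \<open>H\<close> serves all functionals at once. Thus the weights supplied by
  the theorem of the alternative turn finitely many members of the cone into a single one.\<close>

lemma cone_combination:
  assumes K: "closed_gauge_cone K" and "finite I" "\<And>i. i \<in> I \<Longrightarrow> h i \<in> K" "\<And>i. i \<in> I \<Longrightarrow> 0 \<le> l i"
  shows "\<exists>H\<in>K. \<forall>p. additive_functional K p \<longrightarrow> p H = (\<Sum>i\<in>I. l i * p (h i))"
  using assms(2-)
proof (induction I rule: finite_induct)
  case empty
  then show ?case
    using additive_functional_zero[OF K] closed_gauge_coneD(4)[OF K] by (intro bexI[of _ "{0}"]) auto
next
  case (insert i I)
  then obtain H where H: "H \<in> K" "\<And>p. additive_functional K p \<Longrightarrow> p H = (\<Sum>i\<in>I. l i * p (h i))"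
    by (metis insertCI)
  have i: "h i \<in> K" "0 \<le> l i" using insert.prems by auto
  have ih: "(*\<^sub>R) (l i) ` h i \<in> K" using closed_gauge_coneD(3)[OF K i] .
  show ?case
  proof (intro bexI allI impI)
    show "(*\<^sub>R) (l i) ` h i + H \<in> K" using closed_gauge_coneD(2)[OF K ih H(1)] .
    fix p assume p: "additive_functional K p"
    show "p ((*\<^sub>R) (l i) ` h i + H) = (\<Sum>i\<in>insert i I. l i * p (h i))"
      using additive_functionalD(1)[OF p ih H(1)] additive_functionalD(2)[OF p i] H(2)[OF p] insert.hyps
      by simp
  qed
qed

lemma bounded_multiples_nonpos:
  fixes a :: real
  assumes "\<And>t. t > 0 \<Longrightarrow> t * a \<le> b"
  shows "a \<le> 0"
proof (rule le_if_le_add_epsilon_mult)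
  fix e :: real assume "e > 0"
  then show "a \<le> 0 + e * b" using assms[of "1 / e"] by (simp add: field_simps)
qed

text \<open>A Riesz decomposition property. Each pair \<open>(S, T)\<close> of members of the cone admits a suitable
  \<open>w\<close> up to an error, by the formula for the support function of \<open>S \<inter> T\<close>; the theorem of the
  alternative and compactness yield one \<open>w\<close> for all pairs, and scaling removes the error.\<close>

lemma cone_riesz_decomposition:
  fixes K :: "'a::euclidean_space set set"
  assumes K: "closed_gauge_cone K" and meet: "meet_closed K"
    and p: "additive_functional K p" and q: "additive_functional K q"
    and le: "\<And>h. h \<in> K \<Longrightarrow> support_fun h z \<le> p h + q h"
  shows "\<exists>w. \<forall>h\<in>K. support_fun h w \<le> p h \<and> support_fun h (z - w) \<le> q h"
proof (cases "K \<subseteq> {{0}}")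
  case True
  then show ?thesis
    using additive_functional_zero[OF K p] additive_functional_zero[OF K q]
    by (intro exI[of _ 0]) auto
next
  case False
  then obtain h\<^sub>0 where h\<^sub>0: "h\<^sub>0 \<in> K" "h\<^sub>0 \<noteq> {0}" by blast
  define f where "f P w = support_fun (fst P) w + support_fun (snd P) (z - w) - p (fst P) - q (snd P)"
    for P w
  have zero: "{0} \<in> K" "p {0} = 0" "q {0} = 0"
    using K p q by (auto intro: closed_gauge_coneD(4) additive_functional_zero)
  have fig: "h \<in> convex_figures" "h \<in> gauges" if "h \<in> K" for h
    using closed_gauge_coneD(1)[OF K that] gauges_figure by auto
  have pair: "\<exists>w. f (S, T) w < 1" if ST: "S \<in> K" "T \<in> K" for S T
  proof -
    have Int: "S \<inter> T \<in> K" using meet ST by (simp add: meet_closed_def)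
    obtain w where "support_fun S w + support_fun T (z - w) < support_fun (S \<inter> T) z + 1"
      using support_fun_Int_approx[OF fig(2)[OF ST(1)] fig(2)[OF ST(2)] zero_less_one] by blast
    \<comment> \<open>The hypothesis \<open>le\<close> is applied to the meet; monotonicity of
      \<open>p\<close> and \<open>q\<close> then returns to \<open>S\<close> and
      \<open>T\<close>.\<close>
    moreover have "p (S \<inter> T) \<le> p S" "q (S \<inter> T) \<le> q T"
      using additive_functionalD(3)[OF p Int ST(1)] additive_functionalD(3)[OF q Int ST(2)] by auto
    ultimately have "f (S, T) w < 1" using le[OF Int] by (simp add: f_def)
    then show ?thesis by blast
  qed
  have finite: "\<exists>w. \<forall>P\<in>I. f P w < 1" if I: "finite I" "I \<subseteq> K \<times> K" for I
  proof (rule ccontr)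
    assume none: "\<nexists>w. \<forall>P\<in>I. f P w < 1"
    then have "I \<noteq> {}" by blast
    have "\<exists>l. (\<forall>P\<in>I. 0 \<le> l P) \<and> sum l I = 1 \<and> (\<forall>w\<in>UNIV. 0 \<le> (\<Sum>P\<in>I. l P * (f P w - 1)))"
    proof (rule convexlike_alternative[OF I(1) \<open>I \<noteq> {}\<close>])
      fix x y :: 'a and t :: real assume t: "0 \<le> t" "t \<le> 1"
      have conv: "support_fun h ((1 - t) *\<^sub>R x + t *\<^sub>R y) \<le> (1 - t) * support_fun h x + t * support_fun h y"
        if "h \<in> K" for h x y
        using support_fun_add_arg[OF fig(1)[OF that], of "(1 - t) *\<^sub>R x" "t *\<^sub>R y"] t
        by (simp add: support_fun_scale_arg fig[OF that])
      have "f P ((1 - t) *\<^sub>R x + t *\<^sub>R y) - 1 \<le> (1 - t) * (f P x - 1) + t * (f P y - 1)" if "P \<in> I" for P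
      proof -
        have eq: "z - ((1 - t) *\<^sub>R x + t *\<^sub>R y) = (1 - t) *\<^sub>R (z - x) + t *\<^sub>R (z - y)"
          by (simp add: algebra_simps)
        have "fst P \<in> K" "snd P \<in> K" using that I by auto
        from conv[OF this(1), of x y] conv[OF this(2), of "z - x" "z - y"]
        show ?thesis unfolding f_def eq by (simp add: algebra_simps)
      qed
      then show "\<exists>w\<in>UNIV. \<forall>P\<in>I. f P w - 1 \<le> (1 - t) * (f P x - 1) + t * (f P y - 1)" by blast
    next
      fix w
      obtain P where "P \<in> I" "\<not> f P w < 1" using none by blast
      then show "\<exists>P\<in>I. 0 \<le> f P w - 1" by force
    qed
    then obtain l where l: "\<And>P. P \<in> I \<Longrightarrow> 0 \<le> l P" "sum l I = 1"
      "\<And>w. 0 \<le> (\<Sum>P\<in>I. l P * (f P w - 1))" by blast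
    \<comment> \<open>First and second components are combined separately. As \<open>f P w\<close>
      is additive in \<open>P\<close>, its value at the combined pair is the weighted mean of the
      values over \<open>I\<close>, and \<open>pair\<close> contradicts the choice of
      weights.\<close>
    obtain S where S: "S \<in> K" "\<And>p. additive_functional K p \<Longrightarrow> p S = (\<Sum>P\<in>I. l P * p (fst P))"
      using cone_combination[OF K I(1), of fst l] I(2) l(1) by fastforce
    obtain T where T: "T \<in> K" "\<And>p. additive_functional K p \<Longrightarrow> p T = (\<Sum>P\<in>I. l P * p (snd P))"
      using cone_combination[OF K I(1), of snd l] I(2) l(1) by fastforce
    obtain w where w: "f (S, T) w < 1" using pair[OF S(1) T(1)] by blast
    have "f (S, T) w = (\<Sum>P\<in>I. l P * f P w)"
      using S(2)[OF p] T(2)[OF q] S(2)[OF additive_functional_support_fun[OF K]]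
        T(2)[OF additive_functional_support_fun[OF K]]
      by (simp add: f_def right_diff_distrib distrib_left sum_subtractf sum.distrib)
    then have "(\<Sum>P\<in>I. l P * (f P w - 1)) = f (S, T) w - 1"
      using l(2) by (simp add: right_diff_distrib sum_subtractf)
    with w l(3)[of w] show False by simp
  qed
  let ?C = "\<lambda>P. {w. f P w \<le> 1}"
  have closed: "closed (?C P)" if "P \<in> K \<times> K" for P
  proof -
    have "continuous_on UNIV (support_fun (snd P))"
      using that by (intro continuous_on_support_fun fig) auto
    then have "continuous_on UNIV (\<lambda>w. support_fun (snd P) (z - w))"
      by (rule continuous_on_compose2) (auto intro: continuous_intros)
    then show ?thesis
      unfolding f_def using that
      by (intro closed_Collect_le continuous_intros continuous_on_support_fun fig) auto
  qed
  \<comment> \<open>Pairing the ball \<open>h\<^sub>0\<close> with \<open>{0}\<close> leaves a bound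
    on \<open>support_fun h\<^sub>0 w\<close> alone, which confines \<open>w\<close>.\<close>
  have "bounded (?C (h\<^sub>0, {0}))"
  proof -
    obtain r where r: "r > 0" "\<And>w. r * norm w \<le> support_fun h\<^sub>0 w"
      using support_fun_lower_bound[OF fig(1)[OF h\<^sub>0(1)]]
        support_fun_gauge_pos[OF fig(2)[OF h\<^sub>0(1)] h\<^sub>0(2)] by blast
    have "norm w \<le> (1 + p h\<^sub>0) / r" if "w \<in> ?C (h\<^sub>0, {0})" for w
    proof -
      have "support_fun h\<^sub>0 w \<le> 1 + p h\<^sub>0" using that by (simp add: f_def zero)
      with r(2)[of w] have "r * norm w \<le> 1 + p h\<^sub>0" by linarith
      then show ?thesis using r(1) by (simp add: field_simps)
    qed
    then show ?thesis unfolding bounded_iff by blast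
  qed
  then have "compact (?C (h\<^sub>0, {0}))"
    using closed h\<^sub>0(1) zero(1) by (simp add: compact_eq_bounded_closed)
  then have "?C (h\<^sub>0, {0}) \<inter> (\<Inter>P\<in>K \<times> K. ?C P) \<noteq> {}"
  proof (rule compact_imp_fip_image)
    fix I assume I: "finite I" "I \<subseteq> K \<times> K"
    obtain w where "\<forall>P\<in>insert (h\<^sub>0, {0}) I. f P w < 1"
      using finite[of "insert (h\<^sub>0, {0}) I"] I h\<^sub>0(1) zero(1) by auto
    then show "?C (h\<^sub>0, {0}) \<inter> (\<Inter>P\<in>I. ?C P) \<noteq> {}" by (force intro: less_imp_le)
  qed (rule closed)
  then obtain w where w: "\<And>S T. S \<in> K \<Longrightarrow> T \<in> K \<Longrightarrow> f (S, T) w \<le> 1" by blast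
  have "support_fun h w \<le> p h \<and> support_fun h (z - w) \<le> q h" if h: "h \<in> K" for h
  proof -
    have scaled: "(*\<^sub>R) t ` h \<in> K" if "t > 0" for t
      using closed_gauge_coneD(3)[OF K h] that by simp
    \<comment> \<open>A pair with \<open>{0}\<close> in one place isolates one inequality; since all
      multiples of \<open>h\<close> obey it with the same error 1, the error disappears.\<close>
    have "support_fun h w - p h \<le> 0"
    proof (rule bounded_multiples_nonpos)
      fix t :: real assume t: "t > 0"
      show "t * (support_fun h w - p h) \<le> 1"
        using w[OF scaled[OF t] zero(1)] t additive_functionalD(2)[OF p h, of t]
        by (simp add: f_def zero figure_scale fig h right_diff_distrib)
    qed
    moreover have "support_fun h (z - w) - q h \<le> 0"
    proof (rule bounded_multiples_nonpos)
      fix t :: real assume t: "t > 0"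
      show "t * (support_fun h (z - w) - q h) \<le> 1"
        using w[OF zero(1) scaled[OF t]] t additive_functionalD(2)[OF q h, of t]
        by (simp add: f_def zero figure_scale fig h right_diff_distrib)
    qed
    ultimately show ?thesis by simp
  qed
  then show ?thesis by blast
qed

section \<open>The preorder of a cone and its monotone gauges\<close>

definition cone_order :: "'a::euclidean_space set set \<Rightarrow> ('a \<times> 'a) set" where
  "cone_order K = {(z, x). \<forall>h\<in>K. support_fun h z \<le> support_fun h x}"

lemma cone_subset_monotone_gauges:
  "closed_gauge_cone K \<Longrightarrow> K \<subseteq> monotone_gauges (cone_order K)"
  using closed_gauge_coneD(1) by (auto simp: cone_order_def monotone_gauges_def)

text \<open>Subadditivity relaxes the bound at \<open>x + y\<close> to a sum of evaluations at
  \<open>x\<close> and \<open>y\<close>, and Riesz decomposition for these two functionals supplies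
  \<open>w\<close>.\<close>

lemma meet_closed_monotone_gauges_cone_order:
  fixes K :: "'a::euclidean_space set set"
  assumes K: "closed_gauge_cone K" and meet: "meet_closed K"
  shows "meet_closed (monotone_gauges (cone_order K))"
proof (rule meet_closed_monotone_gauges)
  fix z x y :: 'a assume zxy: "(z, x + y) \<in> cone_order K"
  have "support_fun h z \<le> support_fun h x + support_fun h y" if h: "h \<in> K" for h
  proof -
    have "support_fun h z \<le> support_fun h (x + y)" using zxy h by (simp add: cone_order_def)
    also have "\<dots> \<le> support_fun h x + support_fun h y"
      using closed_gauge_coneD(1)[OF K h] by (intro support_fun_add_arg gauges_figure)
    finally show ?thesis .
  qed
  from cone_riesz_decomposition[OF K meet additive_functional_support_fun[OF K]
      additive_functional_support_fun[OF K] this]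
  show "\<exists>w. (w, x) \<in> cone_order K \<and> (z - w, y) \<in> cone_order K"
    by (auto simp: cone_order_def)
qed

text \<open>Riesz decomposition peels off one summand at a time: monotonicity of \<open>T\<close>
  handles the piece \<open>w\<close>, the induction hypothesis handles \<open>x - w\<close>.\<close>

lemma monotone_gauge_sum_le:
  fixes K :: "'a::euclidean_space set set"
  assumes K: "closed_gauge_cone K" and meet: "meet_closed K"
    and T: "T \<in> monotone_gauges (cone_order K)"
    and "finite I" "\<And>h. h \<in> K \<Longrightarrow> support_fun h x \<le> (\<Sum>i\<in>I. support_fun h (y i))"
  shows "support_fun T x \<le> (\<Sum>i\<in>I. support_fun T (y i))"
  using assms(4,5)
proof (induction I arbitrary: x rule: finite_induct)
  case empty
  \<comment> \<open>The empty sum bounds the support functions by 0, which is their value at the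
    origin.\<close>
  then have "(x, 0) \<in> cone_order K"
    using closed_gauge_coneD(1)[OF K] by (auto simp: cone_order_def gauges_figure)
  from monotone_gaugesD(2)[OF T this] show ?case
    by (simp add: gauges_figure monotone_gaugesD(1)[OF T])
next
  case (insert i I)
  have "support_fun h x \<le> support_fun h (y i) + (\<Sum>i\<in>I. support_fun h (y i))" if "h \<in> K" for h
    using insert.prems[OF that] insert.hyps by simp
  from cone_riesz_decomposition[OF K meet additive_functional_support_fun[OF K]
      additive_functional_sum[OF additive_functional_support_fun[OF K]] this]
  obtain w where w: "\<And>h. h \<in> K \<Longrightarrow> support_fun h w \<le> support_fun h (y i)"
    "\<And>h. h \<in> K \<Longrightarrow> support_fun h (x - w) \<le> (\<Sum>i\<in>I. support_fun h (y i))" by blast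
  have "support_fun T x \<le> support_fun T w + support_fun T (x - w)"
    using support_fun_add_arg[OF gauges_figure[OF monotone_gaugesD(1)[OF T]], of w "x - w"] by simp
  also have "\<dots> \<le> support_fun T (y i) + (\<Sum>i\<in>I. support_fun T (y i))"
    using w by (intro add_mono insert.IH monotone_gaugesD(2)[OF T]) (auto simp: cone_order_def)
  finally show ?case using insert.hyps by simp
qed

subsection \<open>Approximation by joins\<close>

text \<open>If no such \<open>h\<close> exists, the theorem of the alternative provides weights that bound \<open>h x\<close> by
  a combination of the \<open>h y\<close> for all \<open>h\<close> in the cone; \<open>T\<close> then obeys the same bound.\<close>

lemma cone_interpolation_finite:
  fixes K :: "'a::euclidean_space set set"
  assumes K: "closed_gauge_cone K" and meet: "meet_closed K"
    and T: "T \<in> monotone_gauges (cone_order K)"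
    and Y: "finite Y" and e: "e > 0"
  shows "\<exists>h\<in>K. support_fun T x - e < support_fun h x \<and> (\<forall>y\<in>Y. support_fun h y < support_fun T y + e)"
proof (rule ccontr)
  assume none: "\<not> ?thesis"
  have fig: "h \<in> convex_figures" if "h \<in> K" for h
    using closed_gauge_coneD(1)[OF K that] by (rule gauges_figure)
  have figT: "T \<in> convex_figures" using monotone_gaugesD(1)[OF T] by (rule gauges_figure)
  \<comment> \<open>\<open>None\<close> indexes the lower bound at \<open>x\<close>, which keeps it
    apart from the upper bounds even if \<open>x \<in> Y\<close>.\<close>
  define f where "f i h = (case i of None \<Rightarrow> support_fun T x - e - support_fun h x
    | Some y \<Rightarrow> support_fun h y - (support_fun T y + e))" for i h
  let ?I = "insert None (Some ` Y)"
  have "\<exists>l. (\<forall>i\<in>?I. 0 \<le> l i) \<and> sum l ?I = 1 \<and> (\<forall>h\<in>K. 0 \<le> (\<Sum>i\<in>?I. l i * f i h))"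
  proof (rule convexlike_alternative)
    fix S U and t :: real assume *: "S \<in> K" "U \<in> K" "0 \<le> t" "t \<le> 1"
    let ?H = "(*\<^sub>R) (1 - t) ` S + (*\<^sub>R) t ` U"
    have "?H \<in> K" using * by (intro closed_gauge_coneD(2,3)[OF K]) auto
    moreover have "support_fun ?H z = (1 - t) * support_fun S z + t * support_fun U z" for z
      using * by (simp add: figure_plus figure_scale fig)
    then have "f i ?H = (1 - t) * f i S + t * f i U" for i
      by (cases i) (simp_all add: f_def algebra_simps)
    ultimately show "\<exists>w\<in>K. \<forall>i\<in>?I. f i w \<le> (1 - t) * f i S + t * f i U"
      by (intro bexI[of _ ?H]) auto
  next
    fix h assume "h \<in> K"
    with none consider "support_fun h x \<le> support_fun T x - e"
      | y where "y \<in> Y" "support_fun T y + e \<le> support_fun h y"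
      by (meson linorder_not_less)
    then show "\<exists>i\<in>?I. 0 \<le> f i h"
      by cases (force simp: f_def)+
  qed (use Y in auto)
  then obtain l where l: "\<forall>i\<in>?I. 0 \<le> l i" "sum l ?I = 1" "\<And>h. h \<in> K \<Longrightarrow> 0 \<le> (\<Sum>i\<in>?I. l i * f i h)"
    by blast
  define a where "a = l None"
  define m where "m y = l (Some y)" for y
  have sum: "sum g ?I = g None + (\<Sum>y\<in>Y. g (Some y))" for g :: "'a option \<Rightarrow> real"
    using Y by (simp add: sum.reindex)
  have a: "0 \<le> a" and m: "\<And>y. y \<in> Y \<Longrightarrow> 0 \<le> m y" and one: "a + sum m Y = 1"
    using l(1,2) unfolding sum by (auto simp: a_def m_def)
  have ineq: "0 \<le> (\<Sum>y\<in>Y. m y * support_fun h y) - a * support_fun h x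
      + (a * support_fun T x - (\<Sum>y\<in>Y. m y * support_fun T y) - e)" if "h \<in> K" for h
  proof -
    have "(\<Sum>i\<in>?I. l i * f i h) = a * (support_fun T x - e - support_fun h x)
        + (\<Sum>y\<in>Y. m y * (support_fun h y - (support_fun T y + e)))"
      unfolding sum by (simp add: f_def a_def m_def)
    also have "\<dots> = (\<Sum>y\<in>Y. m y * support_fun h y) - a * support_fun h x
      + (a * support_fun T x - (\<Sum>y\<in>Y. m y * support_fun T y) - (a + sum m Y) * e)"
      by (simp add: algebra_simps sum_subtractf sum.distrib sum_distrib_left)
    finally show ?thesis using l(3)[OF that] one by simp
  qed
  have "support_fun h (a *\<^sub>R x) \<le> (\<Sum>y\<in>Y. support_fun h (m y *\<^sub>R y))" if h: "h \<in> K" for h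
  proof -
    \<comment> \<open>Scaling \<open>h\<close> in \<open>ineq\<close> leaves the terms with
      \<open>T\<close> and \<open>e\<close> fixed.\<close>
    have "a * support_fun h x - (\<Sum>y\<in>Y. m y * support_fun h y) \<le> 0"
    proof (rule bounded_multiples_nonpos)
      fix t :: real assume t: "t > 0"
      then have "(*\<^sub>R) t ` h \<in> K" by (intro closed_gauge_coneD(3)[OF K h]) simp
      from ineq[OF this] t
      show "t * (a * support_fun h x - (\<Sum>y\<in>Y. m y * support_fun h y))
        \<le> a * support_fun T x - (\<Sum>y\<in>Y. m y * support_fun T y) - e"
        by (simp add: figure_scale fig h algebra_simps sum_distrib_left)
    qed
    then show ?thesis using a m by (simp add: support_fun_scale_arg fig h)
  qed
  from monotone_gauge_sum_le[OF K meet T Y this]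
  have "a * support_fun T x \<le> (\<Sum>y\<in>Y. m y * support_fun T y)"
    using a m by (simp add: support_fun_scale_arg figT)
  \<comment> \<open>At \<open>h = {0}\<close> only the constant terms of \<open>ineq\<close>
    remain.\<close>
  moreover have "e \<le> a * support_fun T x - (\<Sum>y\<in>Y. m y * support_fun T y)"
    using ineq[OF closed_gauge_coneD(4)[OF K]] by simp
  ultimately show False using e by simp
qed

text \<open>Expands \<open>u\<close> in the basis, whose coefficients have modulus at most 1, and
  uses evenness. Control at finitely many points thereby bounds a gauge on the whole sphere.\<close>

lemma support_fun_le_sum_Basis:
  fixes T :: "'a::euclidean_space set"
  assumes T: "T \<in> gauges" and u: "norm u \<le> 1"
  shows "support_fun T u \<le> (\<Sum>b\<in>Basis. support_fun T b)"
proof -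
  note fig = gauges_figure[OF T]
  have "support_fun T (\<Sum>b\<in>B. (u \<bullet> b) *\<^sub>R b) \<le> (\<Sum>b\<in>B. support_fun T b)"
    if "finite B" "B \<subseteq> Basis" for B
    using that
  proof (induction B rule: finite_induct)
    case empty
    then show ?case by (simp add: fig)
  next
    case (insert b B)
    have "support_fun T ((u \<bullet> b) *\<^sub>R b) = \<bar>u \<bullet> b\<bar> * support_fun T b"
    proof (cases "u \<bullet> b \<ge> 0")
      case False
      then have "support_fun T ((u \<bullet> b) *\<^sub>R b) = support_fun T (\<bar>u \<bullet> b\<bar> *\<^sub>R (- b))" by simp
      also have "\<dots> = \<bar>u \<bullet> b\<bar> * support_fun T b"
        using T by (subst support_fun_scale_arg[OF fig]) (auto simp: gauges_iff)
      finally show ?thesis .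
    qed (simp add: support_fun_scale_arg fig)
    also have "\<dots> \<le> support_fun T b"
    proof (rule mult_left_le_one_le)
      show "\<bar>u \<bullet> b\<bar> \<le> 1"
        using Cauchy_Schwarz_ineq2[of u b] u insert.prems by (simp add: subset_iff)
    qed (auto intro: support_fun_gauge_nonneg T)
    finally show ?case
      using support_fun_add_arg[OF fig, of "(u \<bullet> b) *\<^sub>R b" "\<Sum>b\<in>B. (u \<bullet> b) *\<^sub>R b"] insert by simp
  qed
  from this[of Basis] show ?thesis by (simp add: euclidean_representation)
qed

text \<open>The finite version is applied to a fine net of the sphere together with the basis. The
  basis bounds \<open>h\<close> by a constant \<open>M\<close> known before \<open>h\<close> is
  chosen, so \<open>h\<close> and \<open>T\<close> share a Lipschitz constant and the estimate
  spreads from the net to the sphere.\<close>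

lemma cone_interpolation:
  fixes K :: "'a::euclidean_space set set"
  assumes K: "closed_gauge_cone K" and meet: "meet_closed K"
    and T: "T \<in> monotone_gauges (cone_order K)" and e: "e > 0"
  shows "\<exists>h\<in>K. support_fun T x - e < support_fun h x \<and>
    (\<forall>u\<in>sphere 0 1. support_fun h u < support_fun T u + e)"
proof -
  note gaugeT = monotone_gaugesD(1)[OF T]
  define M where "M = (\<Sum>b\<in>Basis. support_fun T (b::'a) + e)"
  have "M \<ge> 0"
    unfolding M_def using e support_fun_gauge_nonneg[OF gaugeT] by (intro sum_nonneg) (simp add: add_nonneg_nonneg)
  \<comment> \<open>Moving to the net and back costs at most \<open>2 * (M * d)\<close>, which this
    choice keeps within \<open>e / 2\<close>.\<close>
  define d where "d = e / (4 * (M + 1))"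
  have d: "d > 0" using e \<open>M \<ge> 0\<close> by (simp add: d_def)
  have Md: "2 * (M * d) \<le> e / 2"
  proof -
    have "2 * (M * d) \<le> 2 * ((M + 1) * d)" using d by (intro mult_left_mono mult_right_mono) auto
    also have "\<dots> = e / 2" using \<open>M \<ge> 0\<close> by (simp add: d_def field_simps)
    finally show ?thesis .
  qed
  have "compact (sphere (0::'a) 1)" by simp
  then obtain Y where Y: "finite Y" "sphere (0::'a) 1 \<subseteq> (\<Union>y\<in>Y. ball y d)"
    unfolding compact_eq_totally_bounded using d by meson
  obtain h where h: "h \<in> K" "support_fun T x - e / 2 < support_fun h x"
    "\<And>y. y \<in> Y \<union> Basis \<Longrightarrow> support_fun h y < support_fun T y + e / 2"
    using cone_interpolation_finite[OF K meet T, of "Y \<union> Basis" "e / 2" x] Y(1) e by auto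
  note gaugeh = closed_gauge_coneD(1)[OF K h(1)]
  have hM: "support_fun h u \<le> M" if "u \<in> sphere 0 1" for u
  proof -
    have "support_fun h u \<le> (\<Sum>b\<in>Basis. support_fun h b)"
      using that by (intro support_fun_le_sum_Basis gaugeh) simp
    also have "\<dots> \<le> M"
      unfolding M_def
    proof (rule sum_mono)
      fix b :: 'a assume "b \<in> Basis"
      then show "support_fun h b \<le> support_fun T b + e" using h(3)[of b] e by simp
    qed
    finally show ?thesis .
  qed
  have TM: "support_fun T u \<le> M" if "u \<in> sphere 0 1" for u
  proof -
    have "support_fun T u \<le> (\<Sum>b\<in>Basis. support_fun T b)"
      using that by (intro support_fun_le_sum_Basis gaugeT) simp
    also have "\<dots> \<le> M"
      unfolding M_def using e by (intro sum_mono) simp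
    finally show ?thesis .
  qed
  have "support_fun h u < support_fun T u + e" if u: "u \<in> sphere 0 1" for u
  proof -
    obtain y where y: "y \<in> Y" "dist y u < d" using Y(2) u by auto
    have "M * dist u y \<le> M * d" "M * dist y u \<le> M * d"
      using y(2) \<open>M \<ge> 0\<close> by (auto intro!: mult_left_mono simp: dist_commute)
    moreover have "support_fun h u \<le> support_fun h y + M * dist u y"
      using hM by (intro support_fun_Lipschitz gauges_figure gaugeh)
    moreover have "support_fun h y < support_fun T y + e / 2" using h(3) y(1) by blast
    moreover have "support_fun T y \<le> support_fun T u + M * dist y u"
      using TM by (intro support_fun_Lipschitz gauges_figure gaugeT)
    ultimately show ?thesis using Md by linarith
  qed
  moreover have "support_fun T x - e < support_fun h x" using h(2) e by simp
  ultimately show ?thesis using h(1) by blast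
qed

lemma join_closed_finite:
  assumes L: "closed_gauge_cone L" "join_closed L" and "finite F" "F \<noteq> {}" "F \<subseteq> L"
  shows "\<exists>J\<in>L. \<forall>z. (\<forall>h\<in>F. support_fun h z \<le> support_fun J z) \<and> (\<exists>h\<in>F. support_fun J z = support_fun h z)"
  using assms(3-)
proof (induction F rule: finite_ne_induct)
  case (singleton h)
  then show ?case by (intro bexI[of _ h]) auto
next
  case (insert h F)
  then obtain J where J: "J \<in> L" "\<And>z h. h \<in> F \<Longrightarrow> support_fun h z \<le> support_fun J z"
    "\<And>z. \<exists>h\<in>F. support_fun J z = support_fun h z" by auto
  have h: "h \<in> L" using insert.prems by simp
  have max: "support_fun (join {h, J}) z = max (support_fun h z) (support_fun J z)" for z
    by (intro figure_join gauges_figure closed_gauge_coneD(1)[OF L(1)] h J(1))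
  show ?case
  proof (rule bexI[of _ "join {h, J}"], intro allI conjI ballI)
    show "join {h, J} \<in> L" using L(2) h J(1) by (simp add: join_closed_def)
    fix z
    show "support_fun g z \<le> support_fun (join {h, J}) z" if "g \<in> insert h F" for g
      using that J(2)[of g z] by (auto simp: max le_max_iff_disj)
    show "\<exists>g\<in>insert h F. support_fun (join {h, J}) z = support_fun g z"
      using J(3)[of z] by (auto simp: max max_def)
  qed
qed

text \<open>The Kakutani-Stone argument: for each \<open>x\<close> some \<open>h x\<close> in
  \<open>K\<close> is below \<open>T + e\<close> on the sphere and above \<open>T - e\<close> near
  \<open>x\<close>. The join of finitely many of them is above \<open>T - e\<close> everywhere and
  still below \<open>T + e\<close>; closedness of \<open>L\<close> then gives
  \<open>T\<close>.\<close>

lemma monotone_gauges_subset: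
  fixes K :: "'a::euclidean_space set set"
  assumes K: "closed_gauge_cone K" and meet: "meet_closed K"
    and L: "closed_gauge_cone L" "join_closed L" and sub: "K \<subseteq> L"
  shows "monotone_gauges (cone_order K) \<subseteq> L"
proof
  fix T assume T: "T \<in> monotone_gauges (cone_order K)"
  note figT = gauges_figure[OF monotone_gaugesD(1)[OF T]]
  have "\<exists>J\<in>L. \<forall>u\<in>sphere 0 1. \<bar>support_fun T u - support_fun J u\<bar> < e" if e: "e > 0" for e
  proof -
    have "\<exists>h. \<forall>x. h x \<in> K \<and> support_fun T x - e < support_fun (h x) x \<and>
        (\<forall>u\<in>sphere 0 1. support_fun (h x) u < support_fun T u + e)"
      using cone_interpolation[OF K meet T e] by (intro choice) blast
    then obtain h where h: "\<And>x. h x \<in> K" "\<And>x. support_fun T x - e < support_fun (h x) x"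
      "\<And>x u. u \<in> sphere 0 1 \<Longrightarrow> support_fun (h x) u < support_fun T u + e" by blast
    let ?U = "\<lambda>x. {u. support_fun T u - e < support_fun (h x) u}"
    have cover: "sphere (0::'a) 1 \<subseteq> (\<Union>x\<in>sphere 0 1. ?U x)" using h(2) by blast
    have op: "open (?U x)" for x
      by (intro open_Collect_less continuous_intros continuous_on_support_fun figT gauges_figure
          closed_gauge_coneD(1)[OF K] h(1))
    obtain X where X: "X \<subseteq> sphere 0 1" "finite X" "sphere (0::'a) 1 \<subseteq> (\<Union>x\<in>X. ?U x)"
      by (rule compactE_image[OF compact_sphere op cover])
    have "sphere (0::'a) 1 \<noteq> {}" by simp
    then have "X \<noteq> {}" using X(3) by blast
    moreover have "h ` X \<subseteq> L" using h(1) sub by blast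
    ultimately obtain J where J: "J \<in> L" "\<And>z x. x \<in> X \<Longrightarrow> support_fun (h x) z \<le> support_fun J z"
      "\<And>z. \<exists>x\<in>X. support_fun J z = support_fun (h x) z"
      using join_closed_finite[OF L, of "h ` X"] X(2) by auto
    have "\<bar>support_fun T u - support_fun J u\<bar> < e" if u: "u \<in> sphere 0 1" for u
    proof -
      obtain x where "x \<in> X" "support_fun T u - e < support_fun (h x) u" using X(3) u by blast
      then have "support_fun T u - e < support_fun J u" using J(2)[of x u] by simp
      moreover obtain x' where "support_fun J u = support_fun (h x') u" using J(3) by blast
      then have "support_fun J u < support_fun T u + e" using h(3)[OF u] by simp
      ultimately show ?thesis by linarith
    qed
    with J(1) show ?thesis by blast
  qed
  from closed_gauge_cone_approx[OF L(1) continuous_on_support_fun[OF figT] this]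
  obtain J where J: "J \<in> L" "\<forall>u\<in>sphere 0 1. support_fun T u = support_fun J u" by blast
  then have "T = J"
    using monotone_gaugesD(1)[OF T] closed_gauge_coneD(1)[OF L(1)] by (intro gauge_eqI) auto
  with J(1) show "T \<in> L" by simp
qed

section \<open>Monotonicity as an intersection formula\<close>

text \<open>In direction \<open>z\<close> the join reaches to the supremum of the quotients of the
  support functions at \<open>z\<close> and at \<open>x\<close>, that is, to the least
  \<open>c\<close> with \<open>z\<close> below \<open>c *\<^sub>R x\<close>. So the inclusion of
  \<open>T\<close> in the scaled joins expresses monotonicity. The reverse inclusion always holds,
  since the join for \<open>x\<close> reaches at most to 1 in direction \<open>x\<close>.\<close>

lemma monotone_gauge_iff_Inter:
  fixes K :: "'a::euclidean_space set set"
  assumes K: "closed_gauge_cone K" and T: "T \<in> gauges" "T \<noteq> {0}"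
  shows "T \<in> monotone_gauges (cone_order K) \<longleftrightarrow>
    T = (\<Inter>x \<in> {x. x \<noteq> 0}. (*\<^sub>R) (support_fun T x) `
      join {(*\<^sub>R) (1 / support_fun S x) ` S | S. S \<in> K \<and> S \<noteq> {0}})"
    (is "_ \<longleftrightarrow> T = (\<Inter>x \<in> ?X. (*\<^sub>R) (support_fun T x) ` ?W x)")
proof -
  note fig = gauges_figure[OF T(1)]
  have gauge: "S \<in> gauges" if "S \<in> K" for S using closed_gauge_coneD(1)[OF K that] .
  have W: "closed (?W x)" "convex (?W x)" for x
    by (auto simp: join_def convex_closure)
  have W_upper: "w \<bullet> z \<le> c"
    if w: "w \<in> ?W x" and x: "x \<noteq> 0"
      and le: "\<And>S. S \<in> K \<Longrightarrow> support_fun S z \<le> c * support_fun S x" for w x z c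
  proof -
    have "?W x \<subseteq> {w. z \<bullet> w \<le> c}"
      unfolding join_def
    proof (intro closure_minimal hull_minimal closed_halfspace_le convex_halfspace_le)
      show "\<Union> {(*\<^sub>R) (1 / support_fun S x) ` S | S. S \<in> K \<and> S \<noteq> {0}} \<subseteq> {w. z \<bullet> w \<le> c}"
      proof clarsimp
        fix S s assume S: "S \<in> K" "S \<noteq> {0}" "s \<in> S"
        have "support_fun S x > 0" using support_fun_gauge_pos[OF gauge[OF S(1)] S(2) x] .
        moreover have "s \<bullet> z \<le> c * support_fun S x"
          using inner_le_support_fun[OF gauges_figure[OF gauge[OF S(1)]] S(3), of z] le[OF S(1)] by linarith
        ultimately show "z \<bullet> s / support_fun S x \<le> c" by (simp add: field_simps inner_commute)
      qed
    qed
    with w show ?thesis by (auto simp: inner_commute)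
  qed
  have mem_W: "s /\<^sub>R support_fun S x \<in> ?W x" if "S \<in> K" "S \<noteq> {0}" "s \<in> S" for S s x
  proof -
    have "s /\<^sub>R support_fun S x \<in> \<Union> {(*\<^sub>R) (1 / support_fun S x) ` S | S. S \<in> K \<and> S \<noteq> {0}}"
      using that by (auto simp: divide_inverse)
    then show ?thesis
      unfolding join_def by (rule subsetD[OF order_trans[OF hull_subset closure_subset]])
  qed
  have pos: "support_fun T x > 0" if "x \<noteq> 0" for x
    using support_fun_gauge_pos[OF T that] .
  have Inter_sub: "(\<Inter>x \<in> ?X. (*\<^sub>R) (support_fun T x) ` ?W x) \<subseteq> T"
  proof
    fix s assume s: "s \<in> (\<Inter>x \<in> ?X. (*\<^sub>R) (support_fun T x) ` ?W x)"
    have "s \<bullet> x \<le> support_fun T x" for x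
    proof (cases "x = 0")
      case False
      then obtain w where w: "w \<in> ?W x" "s = support_fun T x *\<^sub>R w" using s by blast
      have "w \<bullet> x \<le> 1" using W_upper[OF w(1) False, of x 1] by simp
      with pos[OF False] show ?thesis by (simp add: w(2))
    qed (simp add: fig)
    then show "s \<in> T" using mem_figure_iff[OF fig] by blast
  qed
  show ?thesis
  proof
    assume mono: "T \<in> monotone_gauges (cone_order K)"
    \<comment> \<open>Otherwise every point would lie below 0, forcing \<open>T = {0}\<close>. A
      ball in \<open>K\<close> puts 0 into the join, and this makes the separation constant
      \<open>c\<close> positive.\<close>
    have "\<not> K \<subseteq> {{0}}"
    proof
      assume "K \<subseteq> {{0}}"
      then have "(z, 0) \<in> cone_order K" for z by (auto simp: cone_order_def)
      then have "support_fun T z \<le> 0" for z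
        using monotone_gaugesD(2)[OF mono] fig by fastforce
      then have "support_fun T z = 0" for z
        using support_fun_gauge_nonneg[OF T(1)] by (intro antisym)
      then show False using gauge_eq_zero_iff[OF T(1)] T(2) by simp
    qed
    then obtain h\<^sub>0 where h\<^sub>0: "h\<^sub>0 \<in> K" "h\<^sub>0 \<noteq> {0}" by blast
    have "T \<subseteq> (*\<^sub>R) (support_fun T x) ` ?W x" if x: "x \<noteq> 0" for x
    proof
      fix s assume s: "s \<in> T"
      have "s /\<^sub>R support_fun T x \<in> ?W x"
      proof (rule ccontr)
        assume nmem: "\<not> ?thesis"
        obtain z c where zc: "c < (s /\<^sub>R support_fun T x) \<bullet> z" "\<And>w. w \<in> ?W x \<Longrightarrow> w \<bullet> z < c"
          by (rule closed_convex_separation[OF W nmem], rule that)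
        have "0 \<in> ?W x" using mem_W[OF h\<^sub>0 zero_mem_gauge[OF gauge[OF h\<^sub>0(1)]]] by simp
        then have c: "c > 0" using zc(2)[of 0] by simp
        have "support_fun S z \<le> support_fun S (c *\<^sub>R x)" if S: "S \<in> K" for S
        proof (cases "S = {0}")
          case False
          have posS: "support_fun S x > 0" using support_fun_gauge_pos[OF gauge[OF S] False x] .
          have "support_fun S z \<le> c * support_fun S x"
          proof (rule support_fun_le[OF gauges_figure[OF gauge[OF S]]])
            fix s assume "s \<in> S"
            from zc(2)[OF mem_W[OF S False this]]
            show "s \<bullet> z \<le> c * support_fun S x" using posS by (simp add: field_simps)
          qed
          then show ?thesis using c by (simp add: support_fun_scale_arg gauges_figure gauge S)
        qed simp
        then have "(z, c *\<^sub>R x) \<in> cone_order K" by (simp add: cone_order_def)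
        from monotone_gaugesD(2)[OF mono this] have "support_fun T z \<le> c * support_fun T x"
          using c by (simp add: support_fun_scale_arg fig)
        with inner_le_support_fun[OF fig s, of z] have "s \<bullet> z \<le> c * support_fun T x" by linarith
        with zc(1) pos[OF x] show False by (simp add: field_simps)
      qed
      moreover have "s = support_fun T x *\<^sub>R (s /\<^sub>R support_fun T x)" using pos[OF x] by simp
      ultimately show "s \<in> (*\<^sub>R) (support_fun T x) ` ?W x" by blast
    qed
    then show "T = (\<Inter>x \<in> ?X. (*\<^sub>R) (support_fun T x) ` ?W x)"
      using Inter_sub by blast
  next
    assume eq: "T = (\<Inter>x \<in> ?X. (*\<^sub>R) (support_fun T x) ` ?W x)"
    show "T \<in> monotone_gauges (cone_order K)"
    proof (rule monotone_gaugesI[OF T(1)])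
      fix z x assume zx: "(z, x) \<in> cone_order K"
      have sub: "T \<subseteq> (*\<^sub>R) (support_fun T y) ` ?W y" if "y \<noteq> 0" for y
        using eq that by blast
      show "support_fun T z \<le> support_fun T x"
      proof (cases "x = 0")
        case False
        show ?thesis
        proof (rule support_fun_le[OF fig])
          fix s assume "s \<in> T"
          then obtain w where w: "w \<in> ?W x" "s = support_fun T x *\<^sub>R w" using sub[OF False] by blast
          have "w \<bullet> z \<le> 1"
            using zx by (intro W_upper[OF w(1) False]) (auto simp: cone_order_def)
          with pos[OF False] show "s \<bullet> z \<le> support_fun T x" by (simp add: w(2))
        qed
      next
        \<comment> \<open>The formula omits \<open>x = 0\<close>. It does force \<open>K\<close> to
          contain a ball, since an empty join would make \<open>T\<close> empty, and then only
          \<open>z = 0\<close> lies below the origin.\<close>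
        case True
        obtain b :: 'a where b: "b \<noteq> 0" using nonzero_Basis SOME_Basis by blast
        have "\<not> K \<subseteq> {{0}}"
        proof
          assume "K \<subseteq> {{0}}"
          then have "?W b = {}" by (auto simp: join_def)
          then have "T = {}" using sub[OF b] by auto
          then show False using convex_figuresD(1)[OF fig] by simp
        qed
        then obtain h\<^sub>0 where h\<^sub>0: "h\<^sub>0 \<in> K" "h\<^sub>0 \<noteq> {0}" by blast
        have "support_fun h\<^sub>0 z \<le> 0"
          using zx h\<^sub>0(1) True gauges_figure[OF gauge[OF h\<^sub>0(1)]] by (auto simp: cone_order_def)
        then have "z = 0" using support_fun_gauge_pos[OF gauge[OF h\<^sub>0(1)] h\<^sub>0(2), of z] by force
        with True show ?thesis by simp
      qed
    qed
  qed
qed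

theorem corollary5p3:
  fixes S :: "'i \<Rightarrow> (real ^ 'n) set" and \<Xi> :: "'i set"
  assumes "nondegenerate \<Xi> S"
  shows "full_hull (S ` \<Xi>) = upper_hull (lower_hull (S ` \<Xi>)) \<and>
    (\<forall>T \<in> gauges. T \<noteq> {0} \<longrightarrow>
      (T \<in> full_hull (S ` \<Xi>) \<longleftrightarrow>
       T = (\<Inter>x \<in> {x. x \<noteq> 0}.
              (*\<^sub>R) (support_fun T x) `
                join {(*\<^sub>R) (1 / support_fun S\<^sub>0 x) ` S\<^sub>0 | S\<^sub>0.
                        S\<^sub>0 \<in> lower_hull (S ` \<Xi>) \<and> S\<^sub>0 \<noteq> {0}})))"
proof -
  let ?K = "lower_hull (S ` \<Xi>)"
  let ?G = "monotone_gauges (cone_order ?K)"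
  note K = nondegenerate_lower_hull(1,2)[OF assms]
  \<comment> \<open>This absorption property is what closedness of \<open>?G\<close> rests
    on.\<close>
  have "\<exists>c\<ge>0. (z, c *\<^sub>R y) \<in> cone_order ?K" if "y \<noteq> 0" for y z
    using nondegenerate_lower_hull(3)[OF assms that, of z] by (simp add: cone_order_def)
  then have G: "closed_gauge_cone ?G" "join_closed ?G" "meet_closed ?G"
    by (auto intro: closed_gauge_cone_monotone_gauges join_closed_monotone_gauges
        meet_closed_monotone_gauges_cone_order K)
  have "S ` \<Xi> \<subseteq> ?K" unfolding lower_hull_def by (rule hull_subset)
  then have "full_hull (S ` \<Xi>) \<subseteq> ?G"
    unfolding full_hull_def using G cone_subset_monotone_gauges[OF K(1)] by (intro hull_minimal) auto
  moreover have "?G \<subseteq> upper_hull ?K"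
    unfolding upper_hull_def hull_def using monotone_gauges_subset[OF K] by blast
  \<comment> \<open>Closes the cycle of inclusions through \<open>?G\<close>: a cone stable under
    both operations contains first \<open>?K\<close> and then its upper hull.\<close>
  moreover have "upper_hull ?K \<subseteq> full_hull (S ` \<Xi>)"
  proof -
    have "upper_hull ?K \<subseteq> M"
      if M: "closed_gauge_cone M" "join_closed M" "meet_closed M" "S ` \<Xi> \<subseteq> M" for M
    proof -
      have "?K \<subseteq> M" unfolding lower_hull_def using M by (intro hull_minimal) auto
      then show ?thesis unfolding upper_hull_def using M by (intro hull_minimal) auto
    qed
    then show ?thesis unfolding full_hull_def hull_def by blast
  qed
  ultimately have "full_hull (S ` \<Xi>) = upper_hull ?K" "full_hull (S ` \<Xi>) = ?G" by blast+
  then show ?thesis using monotone_gauge_iff_Inter[OF K(1)] by simp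
qed

end
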